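(* Let $(a,b,c,d)$ be a state of four vessels with positive integer entries, and let $n=a+b+c+d$. Then the Four Vessel Pouring Algorithm (listed in full in the context), started from $(a,b,c,d)$, empties one of the four vessels in $\mathcal{O}(\log n\,\log\log n)$ pourings.
   Context: A state is a vector of non-negative integers, the contents (values) of the vessels. $|X|$ denotes the current content of vessel $X$, and $\log$ denotes $\log_2$. "Pour from $X$ to $Y$" (a pouring or pouring step, allowed when $|Y|\le |X|$) replaces $|Y|$ by $2|Y|$ and $|X|$ by $|X|-|Y|$, and leaves the other contents unchanged. A vessel is empty if its content is $0$. For an integer $k\ge 0$, a nonzero integer is $k$-even if $2^k$ divides it, $k$-odd if $2^k$ does not divide it, and exactly $k$-even if it is $k$-even but not $(k+1)$-even. A vessel is called $k$-even, $k$-odd or exactly $k$-even if its content is. JANSON ROUND, applied to vessels $A,B,C$ with contents $a\le b\le c$, $a\ge 1$: let $p=\lfloor b/a\rfloor=\sum_{i=0}^{\lfloor\log p\rfloor}p_i2^i$ with $p_i\in\{0,1\}$. For $i=0,1,\dots,\lfloor\log p\rfloor$: if $p_i=1$, pour from $B$ to $A$; otherwise pour from $C$ to $A$. FREI ROUND, applied to vessels $A,B,C$ with contents $a\le b\le c$, $a\ge 1$: let $p=\lfloor b/a\rfloor$, $q=\lceil b/a\rceil$, $r_1=b-pa$, $r_2=qa-b$. If $r_1\le r_2$, apply the Janson round. Otherwise write $q=\sum_{i=0}^{\lfloor\log q\rfloor}q_i2^i$ with $q_i\in\{0,1\}$; for $i=0,1,\dots,\lfloor\log q\rfloor-1$: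 if $q_i=1$, pour from $B$ to $A$, otherwise pour from $C$ to $A$; after this loop, pour from $A$ to $B$. FOUR VESSEL POURING ALGORITHM, with input a state $(a,b,c,d)$ of positive integers with sum $n$. Below, "Rename" means: rename $A,B,C$ so that $|A|\le|B|\le|C|$, and stop the algorithm if $|A|=0$. (1) Apply the Frei round several times to the three vessels with smallest content, until the smallest vessel has value smaller than $\frac{n}{2\log n}$. (2) Order the vessels by their content and call them $A,B,C,D$ (with $D$ the largest; from now on $D$ is only poured out of, never into, and is called the pool rather than a vessel). (3) Let $e$ be such that $\gcd(|A|,|B|,|C|)$ is exactly $e$-even. (4) While $\min\{|A|,|B|,|C|\}>0$, do the following: (4.1) If $|A|\ge\frac{n}{4\log n}$, apply the Frei round to $A,B,C$. (4.2) Rename. (4.3) If exactly two of the vessels $A,B,C$ are $(e+1)$-odd: pour from one of these two to the other (if both have equal value, always pour from $C$ to $B$, from $C$ to $A$, or from $B$ to $A$); increase $e$ by $1$; Rename. (4.4) Otherwise (that is, if the condition of (4.3) does not hold), do the following: (i) If exactly three of the vessels $A,B,C$ are $(e+1)$-odd: pour from $C$ to $B$; Rename. (ii) If $|C|$ is $(e+1)$-odd: pour from $C$ to $B$ until $|C|<|B|$; Rename. (iii) If $|B|$ is $(e+1)$-odd and $|B|<\frac{n}{4\log n}$: pour from $D$ to $B$; increase $e$ by $1$; Rename. (iv) Else, if $|B|$ is $(e+1)$-odd and $|B|\ge\frac{n}{4\log n}$: set $t_a=\log\frac{n/(4\log n)}{|A|}$; let $t_c$ be such that $|C|$ is exactly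 $(e+t_c)$-even; set $t=\max\{\min\{\lceil t_a/2\rceil,t_c\},1\}$; pour from $B$ to $A$ exactly $t-1$ times; apply the Janson round to $A,B,C$; Rename; pour from $D$ to $A$ exactly $t$ times; increase $e$ by $t$; Rename. (v) Else, if $|A|$ is $(e+1)$-odd: pour from $D$ to $A$; increase $e$ by $1$; Rename.
   Formalization: In step (4.1), e is determined anew after the Frei round so that gcd(|A|,|B|,|C|) is again exactly e-even; with e changed only by the listed increments the algorithm does not terminate on (5,17,20,58). *)

theory Defs
  imports Complex_Main
begin

datatype vessel = VA | VB | VC | VD

text \<open>
  A configuration of the algorithm. The names \<open>VA\<close>, ..., \<open>VD\<close> are those the algorithm currently
  uses for the vessels, so renaming permutes the contents. The field \<open>evenness\<close> is the variable
  \<open>e\<close>, \<open>pourings\<close> counts the pouring steps made so far, and \<open>stopped\<close> records that a renaming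
  has stopped the algorithm.
\<close>

record config =
  content :: "vessel \<Rightarrow> nat"
  evenness :: nat
  pourings :: nat
  stopped :: bool

text \<open>
  Running a program yields \<open>None\<close> if it attempts a pouring that is not allowed, if it applies a
  round to vessels that violate the requirements of the round, or if it does not terminate.
\<close>

type_synonym prog = "config \<Rightarrow> config option"

fun run :: "prog list \<Rightarrow> prog" where
  "run [] c = Some c"
| "run (P # Ps) c = Option.bind (P c) (\<lambda>c'. if stopped c' then Some c' else run Ps c')"

definition if_else :: "(config \<Rightarrow> bool) \<Rightarrow> prog \<Rightarrow> prog \<Rightarrow> prog" where
  "if_else b P Q c = (if b c then P c else Q c)"

definition if_do :: "(config \<Rightarrow> bool) \<Rightarrow> prog \<Rightarrow> prog" where
  "if_do b P = if_else b P (run [])"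

partial_function (option) while_do :: "(config \<Rightarrow> bool) \<Rightarrow> prog \<Rightarrow> prog" where
  "while_do b P c =
    (if \<not> stopped c \<and> b c then Option.bind (P c) (while_do b P) else Some c)"

definition pour :: "vessel \<Rightarrow> vessel \<Rightarrow> prog" where
  "pour X Y c =
    (if X \<noteq> Y \<and> content c Y \<le> content c X
     then Some (c\<lparr>content := (content c)(X := content c X - content c Y, Y := 2 * content c Y),
                  pourings := pourings c + 1\<rparr>)
     else None)"

definition order_ABCD :: prog where
  "order_ABCD c =
    (let xs = sort [content c VA, content c VB, content c VC, content c VD]
     in Some (c\<lparr>content := (content c)(VA := xs ! 0, VB := xs ! 1, VC := xs ! 2, VD := xs ! 3)\<rparr>))"

definition rename :: prog where
  "rename c =
    (let xs = sort [content c VA, content c VB, content c VC]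
     in Some (c\<lparr>content := (content c)(VA := xs ! 0, VB := xs ! 1, VC := xs ! 2),
                stopped := (xs ! 0 = 0)\<rparr>))"

definition k_even :: "nat \<Rightarrow> nat \<Rightarrow> bool" where
  "k_even k x \<longleftrightarrow> x \<noteq> 0 \<and> 2 ^ k dvd x"

definition k_odd :: "nat \<Rightarrow> nat \<Rightarrow> bool" where
  "k_odd k x \<longleftrightarrow> x \<noteq> 0 \<and> \<not> 2 ^ k dvd x"

definition exactly_even :: "nat \<Rightarrow> nat \<Rightarrow> bool" where
  "exactly_even k x \<longleftrightarrow> k_even k x \<and> \<not> k_even (k + 1) x"

definition set_evenness :: prog where
  "set_evenness c =
    Some (c\<lparr>evenness :=
      (THE e. exactly_even e (gcd (content c VA) (gcd (content c VB) (content c VC))))\<rparr>)"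

definition increase_evenness :: "nat \<Rightarrow> prog" where
  "increase_evenness t c = Some (c\<lparr>evenness := evenness c + t\<rparr>)"

definition round_applicable :: "config \<Rightarrow> bool" where
  "round_applicable c \<longleftrightarrow>
    1 \<le> content c VA \<and> content c VA \<le> content c VB \<and> content c VB \<le> content c VC"

definition floor_log2 :: "nat \<Rightarrow> nat" where
  "floor_log2 p = nat \<lfloor>log 2 (real p)\<rfloor>"

definition pour_by_bits :: "nat \<Rightarrow> nat \<Rightarrow> prog" where
  "pour_by_bits p k = run (map (\<lambda>i. if bit p i then pour VB VA else pour VC VA) [0..<k])"

definition janson_round :: prog where
  "janson_round c =
    (if round_applicable c then
       (let a = content c VA; b = content c VB; p = nat \<lfloor>real b / real a\<rfloor>
        in pour_by_bits p (floor_log2 p + 1) c)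
     else None)"

definition frei_round :: prog where
  "frei_round c =
    (if round_applicable c then
       (let a = content c VA; b = content c VB;
            p = nat \<lfloor>real b / real a\<rfloor>; q = nat \<lceil>real b / real a\<rceil>;
            r1 = b - p * a; r2 = q * a - b
        in if r1 \<le> r2 then janson_round c
           else run [pour_by_bits q (floor_log2 q), pour VA VB] c)
     else None)"

definition odd_vessels :: "config \<Rightarrow> vessel set" where
  "odd_vessels c = {X \<in> {VA, VB, VC}. k_odd (evenness c + 1) (content c X)}"

text \<open>
  The following is used when the contents of \<open>VA\<close>, \<open>VB\<close>, \<open>VC\<close> are ascending and exactly two of
  them are in \<open>odd_vessels\<close>. The only allowed direction is then from the later to the earlier of
  the two, or, for equal contents, the direction prescribed by the algorithm.
\<close>

definition pour_odd_pair :: prog where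
  "pour_odd_pair c =
    (if VA \<notin> odd_vessels c then pour VC VB c
     else if VB \<notin> odd_vessels c then pour VC VA c
     else pour VB VA c)"

definition threshold :: "nat \<Rightarrow> real" where
  "threshold n = real n / (4 * log 2 (real n))"

definition long_step :: "nat \<Rightarrow> prog" where
  "long_step n c =
    (let ta = log 2 (threshold n / real (content c VA));
         tc = (THE t. exactly_even (evenness c + t) (content c VC));
         t = nat (max (min \<lceil>ta / 2\<rceil> (int tc)) 1)
     in run (replicate (t - 1) (pour VB VA) @ [janson_round, rename] @
             replicate t (pour VD VA) @ [increase_evenness t, rename]) c)"

text \<open>
  The variable \<open>e\<close> stands for the number such that the greatest common divisor of the contents of
  \<open>VA\<close>, \<open>VB\<close>, \<open>VC\<close> is exactly \<open>e\<close>-even. The explicit increases keep this true for all other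
  steps, but a Frei round at the beginning of the loop body can itself make the greatest common
  divisor more even, as for contents 5, 17, 20, 58. The variable is therefore determined anew
  after that round. If it kept its old value, no step would apply in this example after the
  round, and the loop would not terminate.
\<close>

definition loop_body :: "nat \<Rightarrow> prog" where
  "loop_body n = run
    [if_do (\<lambda>c. real (content c VA) \<ge> threshold n) (run [frei_round, set_evenness]),
     rename,
     if_else (\<lambda>c. card (odd_vessels c) = 2)
       (run [pour_odd_pair, increase_evenness 1, rename])
       (run
         [if_do (\<lambda>c. card (odd_vessels c) = 3) (run [pour VC VB, rename]),
          if_do (\<lambda>c. VC \<in> odd_vessels c)
            (run [while_do (\<lambda>c. \<not> content c VC < content c VB) (pour VC VB), rename]),
          if_else (\<lambda>c. VB \<in> odd_vessels c \<and> real (content c VB) < threshold n)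
            (run [pour VD VB, increase_evenness 1, rename])
            (if_else (\<lambda>c. VB \<in> odd_vessels c \<and> real (content c VB) \<ge> threshold n)
              (long_step n)
              (if_do (\<lambda>c. VA \<in> odd_vessels c)
                (run [pour VD VA, increase_evenness 1, rename])))])]"

definition four_vessel_pouring :: "nat \<Rightarrow> nat \<Rightarrow> nat \<Rightarrow> nat \<Rightarrow> config option" where
  "four_vessel_pouring a b c d =
    (let n = a + b + c + d in
     run
       [order_ABCD,
        while_do (\<lambda>s. \<not> real (content s VA) < real n / (2 * log 2 (real n)))
          (run [frei_round, order_ABCD]),
        order_ABCD,
        set_evenness,
        while_do (\<lambda>s. Min {content s VA, content s VB, content s VC} > 0) (loop_body n)]
       \<lparr>content = (\<lambda>X. case X of VA \<Rightarrow> a | VB \<Rightarrow> b | VC \<Rightarrow> c | VD \<Rightarrow> d),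
        evenness = 0, pourings = 0, stopped = False\<rparr>)"

end

theory Submission
  imports Defs "HOL-Library.Multiset" "HOL-Computational_Algebra.Primes"
begin

text \<open>
  Write \<open>v\<close> for the 2-adic valuation and \<open>m\<close> for the smallest of the three contents. The proof is
  amortised, with the potential \<open>\<Sum>X\<in>{A, B, C}. min (v X - e) (log (X / m))\<close>. A vessel that is
  \<open>(e+1)\<close>-odd contributes nothing, so it may be changed freely. Pouring \<open>k\<close> times from \<open>C\<close> to \<open>B\<close>
  in step (ii) multiplies \<open>B\<close> by \<open>2 ^ k\<close> and raises both arguments of the minimum by \<open>k\<close>, so
  the potential pays for it. In step (iv) the same happens to \<open>A\<close>, at a loss of at most
  \<open>O(t + log log n)\<close>: the part that \<open>C\<close> can lose is at most \<open>t\<close> if \<open>t = t_c\<close>, and at most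
  \<open>log (C / A) \<le> 2 * t + log log n + 2\<close> if \<open>t \<ge> t_a / 2\<close>. Before a Frei round of the loop, all contents
  are within a factor \<open>O(log n)\<close> of each other, so the potential is \<open>O(log log n)\<close>. In total, a
  loop iteration costs the gain in potential plus \<open>O(log log n)\<close> per increase of \<open>e\<close>, where \<open>e\<close>
  and the potential are \<open>O(log n)\<close>. Each unit of increase of \<open>e\<close> takes on average at most \<open>n / (4 log n)\<close> from the
  pool, hence the pool, which starts with at least \<open>n / 4\<close>, suffices.
\<close>

section \<open>Configurations and programs\<close>

text \<open>A normal form in which updates of contents act on the four arguments, so that the
  simplifier can execute programs symbolically.\<close>

definition cfg :: "nat \<Rightarrow> nat \<Rightarrow> nat \<Rightarrow> nat \<Rightarrow> nat \<Rightarrow> nat \<Rightarrow> bool \<Rightarrow> config" where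
  "cfg a b c d e p st =
    \<lparr>content = case_vessel a b c d, evenness = e, pourings = p, stopped = st\<rparr>"

lemma cfg_sel [simp]:
  "content (cfg a b c d e p st) = case_vessel a b c d"
  "evenness (cfg a b c d e p st) = e"
  "pourings (cfg a b c d e p st) = p"
  "stopped (cfg a b c d e p st) = st"
  by (simp_all add: cfg_def)

lemma case_vessel_upd [simp]:
  "(case_vessel a b c d)(VA := x) = case_vessel x b c d"
  "(case_vessel a b c d)(VB := x) = case_vessel a x c d"
  "(case_vessel a b c d)(VC := x) = case_vessel a b x d"
  "(case_vessel a b c d)(VD := x) = case_vessel a b c x"
  by (auto simp: fun_eq_iff split: vessel.split)

text \<open>Total correctness: \<open>None\<close> covers forbidden pourings and nontermination, so
  a proof of \<open>yields\<close> excludes both.\<close>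

definition yields :: "'a option \<Rightarrow> ('a \<Rightarrow> bool) \<Rightarrow> bool" where
  "yields x Q \<longleftrightarrow> (\<exists>s. x = Some s \<and> Q s)"

lemma yields_Some [simp]: "yields (Some s) Q = Q s"
  by (simp add: yields_def)

lemma yields_mono: "yields x Q \<Longrightarrow> (\<And>s. Q s \<Longrightarrow> Q' s) \<Longrightarrow> yields x Q'"
  by (auto simp: yields_def)

lemma yields_bind: "yields (Option.bind x f) Q \<longleftrightarrow> yields x (\<lambda>s. yields (f s) Q)"
  by (cases x) (auto simp: yields_def)

lemma yields_run_Cons:
  "yields (run (P # Ps) s) Q \<longleftrightarrow>
    yields (P s) (\<lambda>s'. if stopped s' then Q s' else yields (run Ps s') Q)"
  by (simp add: yields_bind if_distrib[of "\<lambda>x. yields x Q"] cong: if_cong)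

declare run.simps(2) [simp del]

lemma run_Nil_if_stopped [simp]: "(\<lambda>s. if stopped s then Some s else run [] s) = Some"
  by auto

lemma run_append:
  "\<not> stopped s \<Longrightarrow>
    run (Ps @ Ps') s = Option.bind (run Ps s) (\<lambda>s'. if stopped s' then Some s' else run Ps' s')"
proof (induction Ps arbitrary: s)
  case (Cons P Ps)
  then show ?case by (cases "P s") (simp_all add: run.simps(2))
qed simp

lemma pour_cfg [simp]:
  "a \<le> b \<Longrightarrow> pour VB VA (cfg a b c d e p st) = Some (cfg (2 * a) (b - a) c d e (Suc p) st)"
  "a \<le> c \<Longrightarrow> pour VC VA (cfg a b c d e p st) = Some (cfg (2 * a) b (c - a) d e (Suc p) st)"
  "b \<le> c \<Longrightarrow> pour VC VB (cfg a b c d e p st) = Some (cfg a (2 * b) (c - b) d e (Suc p) st)"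
  "b \<le> a \<Longrightarrow> pour VA VB (cfg a b c d e p st) = Some (cfg (a - b) (2 * b) c d e (Suc p) st)"
  "a \<le> d \<Longrightarrow> pour VD VA (cfg a b c d e p st) = Some (cfg (2 * a) b c (d - a) e (Suc p) st)"
  "b \<le> d \<Longrightarrow> pour VD VB (cfg a b c d e p st) = Some (cfg a (2 * b) c (d - b) e (Suc p) st)"
  by (simp_all add: pour_def cfg_def)

lemma increase_evenness_cfg [simp]:
  "increase_evenness t (cfg a b c d e p st) = Some (cfg a b c d (e + t) p st)"
  by (simp add: increase_evenness_def cfg_def)

text \<open>The sorted list is kept abstract. The multiset equation carries everything symmetric in
  the three contents over to the renamed vessels.\<close>

lemma rename_cfg:
  obtains x y z where
    "rename (cfg a b c d e p st) = Some (cfg x y z d e p (x = 0))"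
    "x \<le> y" "y \<le> z" "{#x, y, z#} = {#a, b, c#}"
proof -
  let ?xs = "sort [a, b, c]"
  have "length ?xs = Suc (Suc (Suc 0))"
    by (simp only: length_sort length_Cons list.size(3))
  then obtain x y z where xs: "?xs = [x, y, z]"
    unfolding length_Suc_conv length_0_conv by blast
  have "sorted [x, y, z]" "mset [x, y, z] = mset [a, b, c]"
    unfolding xs[symmetric] by (rule sorted_sort) simp
  moreover have "rename (cfg a b c d e p st) = Some (cfg x y z d e p (x = 0))"
    unfolding rename_def cfg_sel vessel.case Let_def xs by (simp add: cfg_def)
  ultimately show thesis by (intro that[of x y z]) simp_all
qed

lemma order_ABCD_cfg:
  obtains w x y z where
    "order_ABCD (cfg a b c d e p st) = Some (cfg w x y z e p st)"
    "w \<le> x" "x \<le> y" "y \<le> z" "{#w, x, y, z#} = {#a, b, c, d#}"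
proof -
  let ?xs = "sort [a, b, c, d]"
  have "length ?xs = Suc (Suc (Suc (Suc 0)))"
    by (simp only: length_sort length_Cons list.size(3))
  then obtain w x y z where xs: "?xs = [w, x, y, z]"
    unfolding length_Suc_conv length_0_conv by blast
  have "sorted [w, x, y, z]" "mset [w, x, y, z] = mset [a, b, c, d]"
    unfolding xs[symmetric] by (rule sorted_sort) simp
  moreover have "order_ABCD (cfg a b c d e p st) = Some (cfg w x y z e p st)"
    unfolding order_ABCD_def cfg_sel vessel.case Let_def xs by (simp add: cfg_def)
  ultimately show thesis by (intro that[of w x y z]) simp_all
qed

lemma exactly_even_iff:
  assumes "0 < w"
  shows "exactly_even k w \<longleftrightarrow> k = multiplicity 2 w"
  using assms power_dvd_iff_le_multiplicity[of w 2 k] power_dvd_iff_le_multiplicity[of w 2 "Suc k"]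
  by (auto simp: exactly_even_def k_even_def)

text \<open>The maximality in the last conclusion later shows that a Frei round cannot lower
  \<open>e\<close>.\<close>

lemma set_evenness_cfg:
  assumes "0 < a + b + c"
  obtains e' where
    "set_evenness (cfg a b c d e p st) = Some (cfg a b c d e' p st)"
    "2 ^ e' dvd a" "2 ^ e' dvd b" "2 ^ e' dvd c"
    "\<not> (2 ^ (e' + 1) dvd a \<and> 2 ^ (e' + 1) dvd b \<and> 2 ^ (e' + 1) dvd c)"
    "\<And>k. 2 ^ k dvd a \<Longrightarrow> 2 ^ k dvd b \<Longrightarrow> 2 ^ k dvd c \<Longrightarrow> k \<le> e'"
proof -
  define g where "g = gcd a (gcd b c)"
  have g: "0 < g" using assms by (auto simp: g_def)
  have dvd: "2 ^ k dvd a \<and> 2 ^ k dvd b \<and> 2 ^ k dvd c \<longleftrightarrow> k \<le> multiplicity 2 g" for k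
    using g power_dvd_iff_le_multiplicity[of g 2 k] by (auto simp: g_def)
  show thesis
  proof (rule that)
    show "set_evenness (cfg a b c d e p st) = Some (cfg a b c d (multiplicity 2 g) p st)"
      using g by (simp add: set_evenness_def exactly_even_iff g_def[symmetric] cfg_def)
  qed (use dvd[of "multiplicity 2 g"] dvd[of "multiplicity 2 g + 1"] dvd in auto)
qed

lemma card_odd_vessels_cfg:
  assumes "0 < a" "0 < b" "0 < c"
  shows "card (odd_vessels (cfg a b c d e p st)) =
    size (filter_mset (\<lambda>w. \<not> 2 ^ (e + 1) dvd w) {#a, b, c#})"
proof -
  have "odd_vessels (cfg a b c d e p st) =
    (if 2 ^ (e + 1) dvd a then {} else {VA}) \<union> (if 2 ^ (e + 1) dvd b then {} else {VB}) \<union>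
    (if 2 ^ (e + 1) dvd c then {} else {VC})"
    using assms by (auto simp: odd_vessels_def k_odd_def)
  then show ?thesis by simp
qed

lemma in_odd_vessels_cfg:
  assumes "0 < a" "0 < b" "0 < c"
  shows "VA \<in> odd_vessels (cfg a b c d e p st) \<longleftrightarrow> \<not> 2 ^ (e + 1) dvd a"
    "VB \<in> odd_vessels (cfg a b c d e p st) \<longleftrightarrow> \<not> 2 ^ (e + 1) dvd b"
    "VC \<in> odd_vessels (cfg a b c d e p st) \<longleftrightarrow> \<not> 2 ^ (e + 1) dvd c"
  using assms by (auto simp: odd_vessels_def k_odd_def)

section \<open>Rounds\<close>

text \<open>Pouring number \<open>i\<close> adds \<open>2 ^ i * a\<close> to A, from B for a one bit
  and from C for a zero bit. Below position \<open>k\<close> the one bits add up to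
  \<open>q mod 2 ^ k\<close> and the zero bits to its complement.\<close>

lemma pour_by_bits_cfg:
  assumes "a * (q mod 2 ^ k) \<le> b" "a * (2 ^ k - 1 - q mod 2 ^ k) \<le> c"
  shows "pour_by_bits q k (cfg a b c d e p False) =
    Some (cfg (2 ^ k * a) (b - a * (q mod 2 ^ k)) (c - a * (2 ^ k - 1 - q mod 2 ^ k)) d e (p + k) False)"
  using assms
proof (induction k)
  case (Suc k)
  define m where "m = q mod 2 ^ k"
  have m: "m < 2 ^ k" by (simp add: m_def)
  have step: "q mod 2 ^ Suc k = m + (if bit q k then 2 ^ k else 0)"
    by (simp add: m_def bit_iff_odd mod2_eq_if mod_mult2_eq[of q "2 ^ k" 2, simplified mult.commute] algebra_simps)
  have le: "a * m \<le> b" "a * (2 ^ k - 1 - m) \<le> c"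
  proof -
    show "a * m \<le> b"
      using Suc.prems(1) unfolding step add_mult_distrib2 by (rule add_leD1)
    have "2 ^ k - 1 - m \<le> 2 ^ Suc k - 1 - q mod 2 ^ Suc k"
      unfolding step by (cases "bit q k") simp_all
    then show "a * (2 ^ k - 1 - m) \<le> c"
      by (rule order_trans[OF mult_le_mono2 Suc.prems(2)])
  qed
  have eq: "pour_by_bits q (Suc k) (cfg a b c d e p False) =
    Option.bind (pour_by_bits q k (cfg a b c d e p False))
      (\<lambda>s'. if stopped s' then Some s'
            else run [if bit q k then pour VB VA else pour VC VA] s')"
    by (simp add: pour_by_bits_def run_append)
  show ?case
  proof (cases "bit q k")
    case True
    have "q mod 2 ^ Suc k = m + 2 ^ k" unfolding step using True by simp
    then have "a * (q mod 2 ^ Suc k) = a * m + 2 ^ k * a" by (simp add: add_mult_distrib2)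
    then have "2 ^ k * a \<le> b - a * m" "b - a * m - 2 ^ k * a = b - a * (q mod 2 ^ Suc k)"
      using Suc.prems(1) by linarith+
    moreover have "2 ^ Suc k - 1 - q mod 2 ^ Suc k = 2 ^ k - 1 - m"
      using True m unfolding step by simp
    ultimately show ?thesis
      unfolding eq using True le Suc.IH by (simp add: run.simps(2) m_def mult.assoc)
  next
    case False
    have z: "2 ^ Suc k - 1 - q mod 2 ^ Suc k = 2 ^ k - 1 - m + 2 ^ k"
      using False m unfolding step by simp
    have "2 ^ k * a \<le> c - a * (2 ^ k - 1 - m)"
      "c - a * (2 ^ k - 1 - m) - 2 ^ k * a = c - a * (2 ^ Suc k - 1 - q mod 2 ^ Suc k)"
      using Suc.prems(2) unfolding z by (auto simp: algebra_simps)
    moreover have "q mod 2 ^ Suc k = m" unfolding step using False by simp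
    ultimately show ?thesis
      unfolding eq using False le Suc.IH by (simp add: run.simps(2) m_def mult.assoc)
  qed
qed (simp add: pour_by_bits_def cfg_def)

lemma floor_log2_bounds:
  assumes "0 < p"
  shows "2 ^ floor_log2 p \<le> p" "p < 2 ^ (floor_log2 p + 1)" "real (floor_log2 p) \<le> log 2 (real p)"
proof -
  have "0 \<le> log 2 (real p)" using assms by simp
  then have k: "real (floor_log2 p) \<le> log 2 (real p)" "log 2 (real p) < real (floor_log2 p) + 1"
    by (auto simp: floor_log2_def)
  then show "real (floor_log2 p) \<le> log 2 (real p)" by simp
  from k(1) have "2 powr real (floor_log2 p) \<le> real p"
    using assms by (simp add: le_log_iff)
  then show "2 ^ floor_log2 p \<le> p" by (simp add: powr_realpow)
  from k(2) have "real p < 2 powr real (floor_log2 p + 1)"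
    using assms by (simp add: log_less_iff add.commute)
  then have "real p < 2 ^ (floor_log2 p + 1)" unfolding powr_realpow[OF zero_less_numeral] .
  then show "p < 2 ^ (floor_log2 p + 1)" using of_nat_less_iff[where 'a = real, of p "2 ^ (floor_log2 p + 1)"] by simp
qed

text \<open>B loses exactly \<open>p * a\<close>, and C loses \<open>a\<close> times the binary
  complement of \<open>p\<close>. As \<open>2 ^ k \<le> p\<close>, this complement is at most
  \<open>p - 1\<close>, so C keeps at least \<open>a + b mod a\<close>. This makes the remainder
  strictly smaller than C in the long step.\<close>

lemma janson_round_cfg:
  assumes "0 < a" "a \<le> b" "b \<le> c"
  defines "p \<equiv> b div a"
  defines "k \<equiv> floor_log2 p"
  shows "janson_round (cfg a b c d e l False) =
      Some (cfg (2 ^ (k + 1) * a) (b mod a) (c - a * (2 ^ (k + 1) - 1 - p)) d e (l + (k + 1)) False)"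
    and "a * (2 ^ (k + 1) - 1 - p) + a + b mod a \<le> c"
proof -
  have p: "0 < p" using assms by (simp add: p_def div_greater_zero_iff)
  note k = floor_log2_bounds[OF p, folded k_def]
  have "2 ^ (k + 1) - 1 - p + 1 \<le> p" using k(1,2) by simp
  then have "a * (2 ^ (k + 1) - 1 - p + 1) \<le> a * p" by (rule mult_le_mono2)
  moreover have ap: "a * p + b mod a = b" by (simp add: p_def)
  ultimately show le: "a * (2 ^ (k + 1) - 1 - p) + a + b mod a \<le> c"
    using assms(3) by (simp add: algebra_simps)
  have mod: "p mod 2 ^ (k + 1) = p" using k(2) by simp
  have "pour_by_bits p (k + 1) (cfg a b c d e l False) =
    Some (cfg (2 ^ (k + 1) * a) (b - a * p) (c - a * (2 ^ (k + 1) - 1 - p)) d e (l + (k + 1)) False)"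
    using pour_by_bits_cfg[of a p "k + 1" b c d e l] le ap unfolding mod by simp
  moreover have "b - a * p = b mod a" using ap by simp
  moreover have "nat \<lfloor>real b / real a\<rfloor> = p"
    by (simp add: p_def floor_divide_of_nat_eq)
  ultimately show "janson_round (cfg a b c d e l False) =
      Some (cfg (2 ^ (k + 1) * a) (b mod a) (c - a * (2 ^ (k + 1) - 1 - p)) d e (l + (k + 1)) False)"
    using assms(1-3) by (simp add: janson_round_def round_applicable_def k_def)
qed

text \<open>The round divides \<open>b\<close> by \<open>a\<close> with rounding to the nearest
  integer, so a remainder of at most \<open>a / 2\<close> ends up in B (Janson branch) or in A.
  Pourings preserve every common divisor.\<close>

lemma frei_round_cfg:
  assumes "0 < a" "a \<le> b" "b \<le> c"
  obtains a' b' c' k where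
    "frei_round (cfg a b c d e l False) = Some (cfg a' b' c' d e (l + k) False)"
    "a' + b' + c' = a + b + c" "2 * min a' b' \<le> a" "real k \<le> log 2 (real b / real a) + 2"
    "\<And>f. f dvd a \<Longrightarrow> f dvd b \<Longrightarrow> f dvd c \<Longrightarrow> f dvd a' \<and> f dvd b' \<and> f dvd c'"
proof -
  define p where "p = b div a"
  define q where "q = nat \<lceil>real b / real a\<rceil>"
  have p: "0 < p" using assms by (simp add: p_def div_greater_zero_iff)
  have floor: "nat \<lfloor>real b / real a\<rfloor> = p"
    by (simp add: p_def floor_divide_of_nat_eq)
  have bp: "b - p * a = b mod a" by (simp add: p_def minus_div_mult_eq_mod)
  have pl: "real p \<le> real b / real a" unfolding p_def by (simp add: of_nat_div_le_of_nat)
  have qp: "q \<le> p + 1"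
  proof -
    have "\<lceil>real b / real a\<rceil> \<le> \<lfloor>real b / real a\<rfloor> + 1" by linarith
    then show ?thesis unfolding q_def floor[symmetric] by linarith
  qed
  have ble: "b \<le> q * a"
  proof -
    have "real b / real a \<le> real q" unfolding q_def by linarith
    then have "real b \<le> real (q * a)" using assms(1) by (simp add: field_simps)
    then show ?thesis by linarith
  qed
  have app: "round_applicable (cfg a b c d e l False)"
    using assms by (simp add: round_applicable_def)
  show thesis
  proof (cases "b - p * a \<le> q * a - b")
    case True
    define k where "k = floor_log2 p"
    note j = janson_round_cfg[OF assms, folded p_def, folded k_def]
    note k = floor_log2_bounds[OF p, folded k_def]
    have fj: "frei_round (cfg a b c d e l False) = janson_round (cfg a b c d e l False)"
      using True app by (simp add: frei_round_def floor Let_def q_def)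
    show thesis
    proof (rule that)
      show "frei_round (cfg a b c d e l False) =
        Some (cfg (2 ^ (k + 1) * a) (b mod a) (c - a * (2 ^ (k + 1) - 1 - p)) d e (l + (k + 1)) False)"
        unfolding fj by (rule j(1))
      define z where "z = 2 ^ (k + 1) - 1 - p"
      have "2 ^ (k + 1) = z + 1 + p" using k(2) by (simp add: z_def)
      moreover have "b = p * a + b mod a" by (simp add: p_def)
      ultimately show "2 ^ (k + 1) * a + b mod a + (c - a * (2 ^ (k + 1) - 1 - p)) = a + b + c"
        using j(2) by (simp flip: z_def add: algebra_simps)
      \<comment> \<open>Since \<open>q \<le> p + 1\<close>, the two distances add up to at most
        \<open>a\<close>; exact division, where \<open>q = p\<close>, is included.\<close>
      from qp have "q * a \<le> (p + 1) * a" by (rule mult_le_mono1)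
      then have "q * a - b \<le> a - b mod a"
        using \<open>b = p * a + b mod a\<close> by (simp add: algebra_simps)
      then have "2 * (b mod a) \<le> a" using True bp mod_less_divisor[OF assms(1), of b] by linarith
      then show "2 * min (2 ^ (k + 1) * a) (b mod a) \<le> a" by simp
      have "log 2 (real p) \<le> log 2 (real b / real a)" using p pl by simp
      then show "real (k + 1) \<le> log 2 (real b / real a) + 2" using k(3) by simp
      show "f dvd 2 ^ (k + 1) * a \<and> f dvd b mod a \<and> f dvd c - a * (2 ^ (k + 1) - 1 - p)"
        if "f dvd a" "f dvd b" "f dvd c" for f
        using that by (simp add: dvd_mod dvd_diff_nat)
    qed
  next
    case False
    have b: "b = p * a + b mod a" by (simp add: p_def)
    have "b mod a \<noteq> 0" using False bp by linarith
    have "p * a < q * a" using b \<open>b mod a \<noteq> 0\<close> ble by linarith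
    then have ndvd: "q = p + 1" using qp by simp
    have q: "0 < q" by (simp add: ndvd)
    define k where "k = floor_log2 q"
    note k = floor_log2_bounds[OF q, folded k_def]
    define m where "m = q mod 2 ^ k"
    have qm: "q = 2 ^ k + m"
    proof -
      have "q div 2 ^ k = 1" using k(1,2)
        by (intro div_nat_eqI) auto
      then show ?thesis unfolding m_def by (metis div_mult_mod_eq mult_1)
    qed
    have m: "m < 2 ^ k" by (simp add: m_def)
    have r: "b mod a < a" using assms(1) by simp
    \<comment> \<open>The loop uses only the bits of \<open>q\<close> below the leading one, so both
      totals are less than \<open>q\<close>, and neither B nor C runs out.\<close>
    have m1: "m \<le> p" "2 ^ k - 1 - m \<le> p" using qm ndvd m by auto
    have "m * a \<le> p * a" "(2 ^ k - 1 - m) * a \<le> p * a"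
      using m1 by (auto intro: mult_le_mono1)
    then have le: "a * m \<le> b" "a * (2 ^ k - 1 - m) \<le> c"
      unfolding mult.commute[of a] using b assms(3) by linarith+
    have bq: "q * a = p * a + a" by (simp add: ndvd)
    have mid: "pour_by_bits q k (cfg a b c d e l False) =
      Some (cfg (2 ^ k * a) (b - a * m) (c - a * (2 ^ k - 1 - m)) d e (l + k) False)"
      using le unfolding m_def by (rule pour_by_bits_cfg)
    \<comment> \<open>After the loop, A exceeds B by \<open>q * a - b\<close>, which is what the
      last pouring leaves in A.\<close>
    have qa: "q * a = 2 ^ k * a + a * m" by (simp add: qm algebra_simps)
    show thesis
    proof (rule that)
      show "frei_round (cfg a b c d e l False) =
        Some (cfg (2 ^ k * a - (b - a * m)) (2 * (b - a * m)) (c - a * (2 ^ k - 1 - m)) d e (l + (k + 1)) False)"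
        using False app mid ble qa
        by (simp add: frei_round_def floor Let_def q_def[symmetric] run.simps(2) k_def)
      have "2 ^ k = (2 ^ k - 1 - m) + 1 + m" using m by simp
      then have "2 ^ k * a = a * (2 ^ k - 1 - m) + a + a * m"
        by (metis add_mult_distrib mult.commute mult_1)
      then show "2 ^ k * a - (b - a * m) + 2 * (b - a * m) + (c - a * (2 ^ k - 1 - m)) = a + b + c"
        using le ble qa by linarith
      have "2 ^ k * a - (b - a * m) = q * a - b" using qa le ble by linarith
      moreover have "2 * (q * a - b) \<le> a" using False bp b bq by linarith
      ultimately show "2 * min (2 ^ k * a - (b - a * m)) (2 * (b - a * m)) \<le> a" by simp
      have "log 2 (real q) \<le> log 2 (2 * (real b / real a))"
        using p pl ndvd by simp
      also have "\<dots> = 1 + log 2 (real b / real a)"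
        using assms by (subst log_mult) auto
      finally show "real (k + 1) \<le> log 2 (real b / real a) + 2" using k(3) by simp
      show "f dvd 2 ^ k * a - (b - a * m) \<and> f dvd 2 * (b - a * m) \<and> f dvd c - a * (2 ^ k - 1 - m)"
        if "f dvd a" "f dvd b" "f dvd c" for f
        using that by (simp add: dvd_diff_nat)
    qed
  qed
qed

lemma replicate_pour_BA:
  assumes "a * (2 ^ k - 1) \<le> b"
  shows "run (replicate k (pour VB VA)) (cfg a b c d e p False) =
    Some (cfg (2 ^ k * a) (b - a * (2 ^ k - 1)) c d e (p + k) False)"
  using assms
proof (induction k arbitrary: a b p)
  case (Suc k)
  define y :: nat where "y = 2 ^ k - 1"
  have y: "2 ^ k = y + 1" by (simp add: y_def)
  then have ys: "2 ^ Suc k = 2 * y + 2" by simp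
  have "a * (2 * y + 1) \<le> b" using Suc.prems unfolding ys by simp
  then have "a \<le> b" "2 * a * y \<le> b - a" by (simp_all add: algebra_simps)
  then show ?case using Suc.IH[of "2 * a" "b - a" "Suc p"]
    by (simp add: run.simps(2) y algebra_simps)
qed simp

lemma replicate_pour_DA:
  assumes "a * (2 ^ k - 1) \<le> d"
  shows "run (replicate k (pour VD VA)) (cfg a b c d e p False) =
    Some (cfg (2 ^ k * a) b c (d - a * (2 ^ k - 1)) e (p + k) False)"
  using assms
proof (induction k arbitrary: a d p)
  case (Suc k)
  define y :: nat where "y = 2 ^ k - 1"
  have y: "2 ^ k = y + 1" by (simp add: y_def)
  then have ys: "2 ^ Suc k = 2 * y + 2" by simp
  have "a * (2 * y + 1) \<le> d" using Suc.prems unfolding ys by simp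
  then have "a \<le> d" "2 * a * y \<le> d - a" by (simp_all add: algebra_simps)
  then show ?case using Suc.IH[of "2 * a" "d - a" "Suc p"]
    by (simp add: run.simps(2) y algebra_simps)
qed simp

section \<open>Potential\<close>

text \<open>The two arguments count the factors 2 of \<open>w\<close> beyond \<open>2 ^ e\<close>
  and the doublings from \<open>m\<close> to \<open>w\<close>. Being real, they may be negative,
  which frees \<open>gain_mono\<close> and \<open>gain_mult\<close> from divisibility and order
  conditions on \<open>w\<close>.\<close>

definition gain :: "nat \<Rightarrow> nat \<Rightarrow> nat \<Rightarrow> real" where
  "gain e m w = min (real (multiplicity 2 w) - real e) (log 2 (real w) - log 2 (real m))"

definition pot :: "nat \<Rightarrow> nat \<Rightarrow> nat multiset \<Rightarrow> real" where
  "pot e m M = (\<Sum>w\<in>#M. gain e m w)"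

lemma le_multiplicity_2: "0 < w \<Longrightarrow> 2 ^ k dvd w \<longleftrightarrow> k \<le> multiplicity 2 (w :: nat)"
  by (rule power_dvd_iff_le_multiplicity) auto

lemma gain_nonneg: "0 < m \<Longrightarrow> m \<le> w \<Longrightarrow> 2 ^ e dvd w \<Longrightarrow> 0 \<le> gain e m w"
  using le_multiplicity_2[of w e] by (simp add: gain_def)

lemma gain_odd: "0 < w \<Longrightarrow> \<not> 2 ^ (e + 1) dvd w \<Longrightarrow> gain e m w \<le> 0"
  using le_multiplicity_2[of w "e + 1"] by (simp add: gain_def min_def del: power_Suc)

lemma gain_self: "gain e w w \<le> 0"
  by (simp add: gain_def)

text \<open>Each argument of the minimum drops by at most \<open>i\<close>: the first through the
  growth of \<open>e\<close>, the second through that of the base. With \<open>i = 0\<close> this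
  covers a base that does not grow.\<close>

lemma gain_mono:
  assumes "0 < m" "0 < m'" "m' \<le> 2 ^ i * m" "e' \<le> e + i"
  shows "gain e m w \<le> gain e' m' w + real i"
proof -
  have "real m' \<le> 2 ^ i * real m"
    using of_nat_mono[OF assms(3), where 'a = real] by simp
  then have "log 2 (real m') \<le> log 2 (2 ^ i * real m)"
    using assms by simp
  also have "\<dots> = real i + log 2 (real m)"
    using assms by (simp add: log_mult log_nat_power)
  finally show ?thesis using assms(4) by (auto simp: gain_def min_def)
qed

lemma gain_mult: "0 < w \<Longrightarrow> gain e m (2 ^ k * w) = gain e m w + real k"
  by (simp add: gain_def prime_elem_multiplicity_mult_distrib multiplicity_same_power'
      log_mult log_nat_power min_def)

lemma gain_le_log: "0 < m \<Longrightarrow> gain e m w \<le> log 2 (real w) - log 2 (real m)"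
  by (simp add: gain_def)

lemma sum_image_mset_eq3:
  "{#x, y, z#} = {#a, b, c#} \<Longrightarrow> f x + f y + f z = f a + f b + (f c :: 'a :: comm_monoid_add)"
  by (drule arg_cong[where f = "\<lambda>M. \<Sum>w\<in>#M. f w"]) (simp add: add.assoc)

text \<open>
  The last conjunct of \<open>admissible\<close> reserves one threshold of the pool for each value that \<open>e\<close> can
  still take below \<open>log n\<close>.
\<close>

definition admissible :: "nat \<Rightarrow> nat multiset \<Rightarrow> nat \<Rightarrow> nat \<Rightarrow> bool" where
  "admissible n M d e \<longleftrightarrow> sum_mset M + d = n \<and> (\<forall>w\<in>#M. 2 ^ e dvd w) \<and>
    (\<exists>w\<in>#M. \<not> 2 ^ (e + 1) dvd w) \<and> threshold n * (log 2 (real n) - real e) \<le> real d"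

section \<open>The loop body\<close>

text \<open>
  A step either stops the algorithm by a renaming, and then \<open>D\<close> holds, or it ends in a running
  configuration satisfying \<open>\<Phi>\<close>.
\<close>

definition outcome ::
  "(config \<Rightarrow> bool) \<Rightarrow> (nat \<Rightarrow> nat \<Rightarrow> nat \<Rightarrow> nat \<Rightarrow> nat \<Rightarrow> nat \<Rightarrow> bool) \<Rightarrow> config \<Rightarrow> bool" where
  "outcome D \<Phi> s \<longleftrightarrow>
    stopped s \<and> D s \<or> (\<exists>a b c d e p. s = cfg a b c d e p False \<and> \<Phi> a b c d e p)"

lemma outcomeI: "\<Phi> a b c d e p \<Longrightarrow> outcome D \<Phi> (cfg a b c d e p False)"
  unfolding outcome_def by blast

text \<open>Sequencing with early exit: a stopped configuration skips \<open>Ps\<close>, and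
  \<open>D\<close> is the same before and after.\<close>

lemma outcome_run_Cons:
  assumes "yields (P s) (outcome D \<Phi>)"
    and "\<And>a b c d e p. \<Phi> a b c d e p \<Longrightarrow> yields (run Ps (cfg a b c d e p False)) (outcome D \<Psi>)"
  shows "yields (run (P # Ps) s) (outcome D \<Psi>)"
  unfolding yields_run_Cons
proof (rule yields_mono[OF assms(1)])
  fix s' assume "outcome D \<Phi> s'"
  then consider "stopped s'" "D s'" | a b c d e p where "s' = cfg a b c d e p False" "\<Phi> a b c d e p"
    unfolding outcome_def by blast
  then show "if stopped s' then outcome D \<Psi> s' else yields (run Ps s') (outcome D \<Psi>)"
  proof cases
    case 1
    then show ?thesis by (simp add: outcome_def)
  next
    case 2
    then show ?thesis using assms(2) by simp
  qed
qed

lemma outcome_run_single: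
  "yields (P s) (outcome D \<Phi>) \<Longrightarrow> yields (run [P] s) (outcome D \<Phi>)"
  unfolding yields_run_Cons by (erule yields_mono) auto

text \<open>Both numbers are odd multiples of \<open>2 ^ e\<close>, and a difference of odd numbers
  is even; a truncated difference is 0.\<close>

lemma dvd_odd_pair:
  fixes u v :: nat
  assumes "2 ^ e dvd u" "2 ^ e dvd v" "\<not> 2 ^ (e + 1) dvd u" "\<not> 2 ^ (e + 1) dvd v"
  shows "2 ^ (e + 1) dvd v - u"
proof -
  obtain i j where ij: "u = 2 ^ e * i" "v = 2 ^ e * j" using assms by (auto elim!: dvdE)
  then have "odd i" "odd j" using assms(3,4) by auto
  then have "even (j - i)" by simp
  then show ?thesis using ij by (auto simp: right_diff_distrib' [symmetric] elim!: evenE)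
qed

lemma set_eq3: "{#x, y, z#} = {#a, b, c#} \<Longrightarrow> {x, y, z} = {a, b, c}"
  by (drule arg_cong[where f = set_mset]) simp

lemma init_cfg:
  "\<lparr>content = (\<lambda>X. case X of VA \<Rightarrow> a | VB \<Rightarrow> b | VC \<Rightarrow> c | VD \<Rightarrow> d),
    evenness = e, pourings = p, stopped = st\<rparr> = cfg a b c d e p st"
  by (simp add: cfg_def)

lemma sum_eq4: "{#w, x, y, z#} = {#a, b, c, d#} \<Longrightarrow> w + x + y + z = a + b + c + (d :: nat)"
  by (drule arg_cong[where f = sum_mset]) simp

lemma set_eq4: "{#w, x, y, z#} = {#a, b, c, d#} \<Longrightarrow> {w, x, y, z} = {a, b, c, d}"
  by (drule arg_cong[where f = set_mset]) simp

lemma yields_if_else: "yields (if_else B P Q s) X = (if B s then yields (P s) X else yields (Q s) X)"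
  by (simp add: if_else_def)

lemma outcome_mono:
  "yields x (outcome D \<Phi>) \<Longrightarrow> (\<And>a b c d e p. \<Phi> a b c d e p \<Longrightarrow> \<Psi> a b c d e p) \<Longrightarrow> yields x (outcome D \<Psi>)"
  by (erule yields_mono) (unfold outcome_def, blast)

text \<open>
  The parameter \<open>R\<close> is the budget of the first phase, before the loop (4).
\<close>

locale pouring_bound =
  fixes n :: nat and R :: real
  assumes n_ge: "4 \<le> n"
begin

abbreviation lg :: real where "lg \<equiv> log 2 (real n)"
abbreviation L :: real where "L \<equiv> log 2 lg"
abbreviation T :: real where "T \<equiv> threshold n"

section \<open>Estimates for \<open>lg\<close>, \<open>L\<close> and \<open>T\<close>\<close>

lemma lg_ge: "2 \<le> lg"
proof -
  have "log 2 4 = (2 :: real)" using log_nat_power[of 2 2 2] by simp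
  moreover have "log 2 4 \<le> lg" using n_ge by simp
  ultimately show ?thesis by linarith
qed

lemma L_ge: "1 \<le> L"
  using lg_ge by simp

text \<open>Lets the quadratic budget of the first phase be absorbed into a multiple of
  \<open>L * lg\<close>.\<close>

lemma L_le: "L \<le> lg"
proof -
  \<comment> \<open>Applying \<open>ln x \<le> x - 1\<close> at \<open>lg / 2\<close> yields slope
    1/2, which is below \<open>ln 2\<close>; at \<open>lg\<close> the slope 1 would be too
    large.\<close>
  have "ln (lg / 2) \<le> lg / 2 - 1" using lg_ge by (intro ln_le_minus_one) simp
  moreover have "ln 2 \<le> (1 :: real)" by (rule less_imp_le[OF ln_2_less_1])
  moreover have half: "1 / 2 \<le> ln (2 :: real)"
    using ln_le_minus_one[of "1 / 2 :: real"] by (simp add: ln_div)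
  ultimately have "ln lg \<le> lg * (1 / 2)" using lg_ge by (simp add: ln_div)
  also have "\<dots> \<le> lg * ln 2"
    using lg_ge half by (intro mult_left_mono) simp_all
  finally have "ln lg \<le> lg * ln 2" .
  then show ?thesis by (simp add: log_def divide_le_eq)
qed

lemma T_pos: "0 < T"
  using n_ge lg_ge by (simp add: threshold_def)

text \<open>The largest of four contents is at least \<open>n / 4\<close>, so the pool initially
  holds \<open>lg\<close> portions of size \<open>T\<close>.\<close>

lemma T_lg: "T * lg = real n / 4"
  using lg_ge by (simp add: threshold_def)

lemma T_le: "2 * T \<le> real n / 4"
  using mult_left_mono[OF lg_ge less_imp_le[OF T_pos]] T_lg by (simp add: mult.commute)

text \<open>The double logarithm comes from here: any content is at most \<open>4 * lg\<close> times
  one that is at least \<open>T\<close>.\<close>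

lemma log_n_T: "log 2 (real n) - log 2 T = L + 2"
proof -
  have "log 2 (real n / T) = log 2 (4 * lg)"
    using lg_ge n_ge by (simp add: threshold_def)
  also have "\<dots> = 2 + L"
    using lg_ge log_nat_power[of 2 2 2] by (simp add: log_mult)
  finally show ?thesis using T_pos n_ge by (simp add: log_divide)
qed

lemma log_le_lg: "0 < w \<Longrightarrow> w \<le> n \<Longrightarrow> log 2 (real w) \<le> lg"
  by simp

section \<open>Accounting invariant and renaming\<close>

text \<open>Half of \<open>40 * L * lg\<close> pays for the growth of \<open>e\<close> up to
  \<open>lg\<close>; the other half absorbs the offset and the potential. Renaming puts an empty
  vessel first.\<close>

definition finished :: "config \<Rightarrow> bool" where
  "finished s \<longleftrightarrow> content s VA = 0 \<and> real (pourings s) \<le> R + 40 * L * lg"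

text \<open>The offset \<open>x\<close> is the debt within one iteration: 0 at its start,
  \<open>11 * L\<close> after (4.1) and (4.2), \<open>12 * L\<close> after (i). The price
  \<open>20 * L\<close> per unit of \<open>e\<close> comes from the accounting of the long
  step.\<close>

definition balanced :: "real \<Rightarrow> nat \<Rightarrow> nat \<Rightarrow> nat \<Rightarrow> nat \<Rightarrow> nat \<Rightarrow> nat \<Rightarrow> bool" where
  "balanced x a b c d e p \<longleftrightarrow> 0 < a \<and> a \<le> b \<and> b \<le> c \<and> admissible n {#a, b, c#} d e \<and>
    real p \<le> R + 20 * L * real e + x + pot e a {#a, b, c#}"

lemma balancedD:
  assumes "balanced x a b c d e p"
  shows "0 < a" "a \<le> b" "b \<le> c" "a + b + c + d = n" "2 ^ e dvd a" "2 ^ e dvd b" "2 ^ e dvd c"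
    "\<not> (2 ^ (e + 1) dvd a \<and> 2 ^ (e + 1) dvd b \<and> 2 ^ (e + 1) dvd c)" "T * (lg - real e) \<le> real d"
    "real p \<le> R + 20 * L * real e + x + (gain e a a + gain e a b + gain e a c)"
  using assms by (auto simp: balanced_def admissible_def pot_def)

lemma evenness_le:
  assumes "balanced x a b c d e p"
  shows "real e \<le> lg"
proof -
  note h = balancedD[OF assms]
  have "2 ^ e \<le> a" using h(1,5) by (simp add: dvd_imp_le)
  then have "(2 :: real) ^ e \<le> real n"
    using h(4) of_nat_mono[of "2 ^ e" n, where 'a = real] by simp
  then show ?thesis using n_ge by (simp add: le_log_iff powr_realpow)
qed

lemma balanced_pourings_le:
  assumes "balanced x a b c d e p"
  shows "real p \<le> R + 20 * L * lg + x + 3 * lg"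
proof -
  note h = balancedD[OF assms]
  have "gain e a w \<le> lg" if "0 < w" "w \<le> n" for w
    using gain_le_log[OF h(1), of e w] log_le_lg[OF that] h(1) zero_le_log_cancel_iff[of 2 "real a"]
    by linarith
  then have "gain e a a \<le> lg" "gain e a b \<le> lg" "gain e a c \<le> lg"
    using h(1-4) by auto
  moreover have "20 * L * real e \<le> 20 * L * lg"
    using evenness_le[OF assms] L_ge by (intro mult_left_mono) auto
  ultimately show ?thesis using h(10) by linarith
qed

text \<open>\<open>u\<close>, \<open>v\<close>, \<open>w\<close> list the contents in an order of
  the caller's choice. The new minimum is only known as a lower bound of them, so the account has to
  balance for every such base \<open>m\<close>.\<close>

lemma yields_rename:
  assumes perm: "{#a, b, c#} = {#u, v, w#}"
    and "admissible n {#u, v, w#} d e"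
    and "u = 0 \<or> v = 0 \<or> w = 0 \<Longrightarrow> real p \<le> R + 40 * L * lg"
    and "\<And>m. 0 < m \<Longrightarrow> m \<le> u \<Longrightarrow> m \<le> v \<Longrightarrow> m \<le> w \<Longrightarrow>
      real p \<le> R + 20 * L * real e + x + (gain e m u + gain e m v + gain e m w)"
    and "\<And>x' y z. balanced x x' y z d e p \<Longrightarrow> {#x', y, z#} = {#u, v, w#} \<Longrightarrow>
      x' \<le> u \<Longrightarrow> x' \<le> v \<Longrightarrow> x' \<le> w \<Longrightarrow> \<Phi> x' y z d e p"
  shows "yields (rename (cfg a b c d e p st)) (outcome finished \<Phi>)"
proof -
  obtain x' y z where r: "rename (cfg a b c d e p st) = Some (cfg x' y z d e p (x' = 0))"
    "x' \<le> y" "y \<le> z" "{#x', y, z#} = {#u, v, w#}"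
    using rename_cfg perm by metis
  have set: "{x', y, z} = {u, v, w}"
    using arg_cong[OF r(4), of set_mset] by simp
  have min: "x' \<le> u" "x' \<le> v" "x' \<le> w" using set r(2,3) by (auto simp: set_eq_iff)
  show ?thesis
  proof (cases "x' = 0")
    case True
    then have "u = 0 \<or> v = 0 \<or> w = 0" using set by auto
    then show ?thesis using True r assms(3) by (simp add: outcome_def finished_def)
  next
    case False
    then have "balanced x x' y z d e p"
      using r assms(2) assms(4)[OF _ min] sum_image_mset_eq3[OF r(4), of "gain e x'"]
      by (simp add: balanced_def r(4) pot_def)
    from assms(5)[OF this r(4) min] show ?thesis using False r(1) by (simp add: outcomeI)
  qed
qed

lemma balanced_perm:
  assumes "balanced x a b c d e p" "{#u, v, w#} = {#a, b, c#}"
  shows "0 < u" "0 < v" "0 < w" "a \<le> u" "a \<le> v" "a \<le> w" "u + v + w + d = n"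
    "2 ^ e dvd u" "2 ^ e dvd v" "2 ^ e dvd w"
    "real p \<le> R + 20 * L * real e + x + (gain e a u + gain e a v + gain e a w)"
proof -
  note h = balancedD[OF assms(1)] and s = set_eq3[OF assms(2)]
  have all: "P u \<and> P v \<and> P w" if "P a" "P b" "P c" for P
    using that s by auto
  have "0 < u \<and> 0 < v \<and> 0 < w" by (rule all) (use h in auto)
  moreover have "a \<le> u \<and> a \<le> v \<and> a \<le> w" by (rule all) (use h in auto)
  moreover have "2 ^ e dvd u \<and> 2 ^ e dvd v \<and> 2 ^ e dvd w" by (rule all) (use h in auto)
  ultimately show "0 < u" "0 < v" "0 < w" "a \<le> u" "a \<le> v" "a \<le> w"
    "2 ^ e dvd u" "2 ^ e dvd v" "2 ^ e dvd w" by auto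
  show "u + v + w + d = n"
    using h(4) sum_image_mset_eq3[OF assms(2), of "\<lambda>x. x"] by simp
  show "real p \<le> R + 20 * L * real e + x + (gain e a u + gain e a v + gain e a w)"
    using h(10) sum_image_mset_eq3[OF assms(2), of "gain e a"] by simp
qed

lemma L_lg: "2 * L \<le> L * lg" "lg \<le> L * lg"
  using mult_left_mono[OF lg_ge, of L] mult_right_mono[OF L_ge, of lg] L_ge lg_ge by auto

section \<open>Two odd vessels\<close>

text \<open>The odd gains are nonpositive before the pouring and may be dropped. Only
  \<open>w\<close> loses potential, at most 1, since \<open>e\<close> rises by 1 and the minimum at
  most doubles. The content \<open>2 * u\<close> witnesses that the new \<open>e\<close> is
  exact.\<close>

lemma pour_pair_balance:
  assumes bal: "balanced (11 * L) a b c d e p" and perm: "{#u, v, w#} = {#a, b, c#}"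
    and uv: "u \<le> v" and odd: "\<not> 2 ^ (e + 1) dvd u" "\<not> 2 ^ (e + 1) dvd v" and even: "2 ^ (e + 1) dvd w"
  shows "admissible n {#2 * u, v - u, w#} d (e + 1)"
    "real (p + 1) \<le> R + 40 * L * lg"
    "\<And>m. \<lbrakk>0 < m; m \<le> 2 * u; m \<le> v - u; m \<le> w\<rbrakk> \<Longrightarrow>
      real (p + 1) \<le> R + 20 * L * real (e + 1) + 0 +
        (gain (e + 1) m (2 * u) + gain (e + 1) m (v - u) + gain (e + 1) m w)"
    "min (2 * u) w \<le> 2 * a"
proof -
  note h = balancedD[OF bal] and q = balanced_perm[OF bal perm]
  have "a = u \<or> a = v \<or> a = w" using set_eq3[OF perm] by auto
  then show min: "min (2 * u) w \<le> 2 * a" using uv by auto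
  have vu: "2 ^ (e + 1) dvd v - u" using dvd_odd_pair q odd by blast
  have "T * (lg - real (e + 1)) \<le> T * (lg - real e)" using T_pos by simp
  then have "T * (lg - real (e + 1)) \<le> real d" using h(9) by linarith
  then show "admissible n {#2 * u, v - u, w#} d (e + 1)"
    using q uv odd even vu by (auto simp: admissible_def)
  show "real (p + 1) \<le> R + 40 * L * lg"
    using balanced_pourings_le[OF bal] L_lg lg_ge unfolding of_nat_add of_nat_1 by linarith
  fix m assume m: "0 < m" "m \<le> 2 * u" "m \<le> v - u" "m \<le> w"
  have "gain e a w \<le> gain (e + 1) m w + real 1"
    using h(1) m min by (intro gain_mono) auto
  moreover have "gain e a u \<le> 0" "gain e a v \<le> 0" using gain_odd q odd by auto
  moreover have "0 \<le> gain (e + 1) m (2 * u)" "0 \<le> gain (e + 1) m (v - u)"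
    using m q(8) vu by (auto intro!: gain_nonneg)
  moreover have "20 * L * real (e + 1) = 20 * L * real e + 20 * L" by (simp add: algebra_simps)
  ultimately show "real (p + 1) \<le> R + 20 * L * real (e + 1) + 0 +
        (gain (e + 1) m (2 * u) + gain (e + 1) m (v - u) + gain (e + 1) m w)"
    using q(11) L_ge by (simp del: of_nat_add)
qed

text \<open>The assertion between iterations: growth of \<open>e\<close> gives termination, and
  \<open>a < 2 * T\<close> lets the next Frei round, which at least halves the minimum, bring it
  below \<open>T\<close>.\<close>

definition advanced :: "nat \<Rightarrow> nat \<Rightarrow> nat \<Rightarrow> nat \<Rightarrow> nat \<Rightarrow> nat \<Rightarrow> nat \<Rightarrow> bool" where
  "advanced e0 a b c d e p \<longleftrightarrow> balanced 0 a b c d e p \<and> e0 < e \<and> real a < 2 * T"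

lemma pour_pair_rename:
  assumes "balanced (11 * L) a b c d e p" "{#u, v, w#} = {#a, b, c#}"
    "u \<le> v" "\<not> 2 ^ (e + 1) dvd u" "\<not> 2 ^ (e + 1) dvd v" "2 ^ (e + 1) dvd w"
    and a: "real a < T" and perm: "{#a', b', c'#} = {#2 * u, v - u, w#}"
  shows "yields (rename (cfg a' b' c' d (e + 1) (p + 1) st)) (outcome finished (advanced e))"
proof -
  note q = pour_pair_balance[OF assms(1-6)]
  have small: "real x < 2 * T" if "x \<le> 2 * u" "x \<le> w" for x
  proof -
    have "x \<le> 2 * a" using that q(4) by linarith
    then show ?thesis using a by linarith
  qed
  show ?thesis
    using yields_rename[OF perm q(1-3)] small by (simp add: advanced_def)
qed

lemma pour_odd_pair_step:
  assumes bal: "balanced (11 * L) a b c d e p" and a: "real a < T"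
    and two: "card (odd_vessels (cfg a b c d e p False)) = 2"
  shows "yields (run [pour_odd_pair, increase_evenness 1, rename] (cfg a b c d e p False))
    (outcome finished (advanced e))"
proof -
  note h = balancedD[OF bal]
  have pos: "0 < a" "0 < b" "0 < c" using h by auto
  note odd = in_odd_vessels_cfg[OF pos, of d e p False]
  have two': "size (filter_mset (\<lambda>w. \<not> 2 ^ (e + 1) dvd w) {#a, b, c#}) = 2"
    using two card_odd_vessels_cfg[OF pos] by metis
  have step: "yields (run [pour_odd_pair, increase_evenness 1, rename] (cfg a b c d e p False)) Q"
    if "pour_odd_pair (cfg a b c d e p False) = Some (cfg a' b' c' d e (p + 1) False)"
      and "yields (rename (cfg a' b' c' d (e + 1) (p + 1) False)) Q" for a' b' c' Q
    using that by (auto simp: run.simps(2) yields_def)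
  consider "2 ^ (e + 1) dvd a" "\<not> 2 ^ (e + 1) dvd b" "\<not> 2 ^ (e + 1) dvd c"
    | "\<not> 2 ^ (e + 1) dvd a" "2 ^ (e + 1) dvd b" "\<not> 2 ^ (e + 1) dvd c"
    | "\<not> 2 ^ (e + 1) dvd a" "\<not> 2 ^ (e + 1) dvd b" "2 ^ (e + 1) dvd c"
    using two' by (auto split: if_splits)
  then show ?thesis
  proof cases
    case 1
    have perm: "{#b, c, a#} = {#a, b, c#}" "{#a, 2 * b, c - b#} = {#2 * b, c - b, a#}"
      by (simp_all add: add_mset_commute)
    show ?thesis
      by (rule step[OF _ pour_pair_rename[OF bal perm(1) h(3) 1(2,3,1) a perm(2)]])
        (use 1 h(3) in \<open>simp add: pour_odd_pair_def odd\<close>)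
  next
    case 2
    have perm: "{#a, c, b#} = {#a, b, c#}" "{#2 * a, b, c - a#} = {#2 * a, c - a, b#}"
      by (simp_all add: add_mset_commute)
    show ?thesis
      by (rule step[OF _ pour_pair_rename[OF bal perm(1) _ 2(1,3,2) a perm(2)]])
        (use 2 h(2,3) in \<open>simp_all add: pour_odd_pair_def odd\<close>)
  next
    case 3
    show ?thesis
      by (rule step[OF _ pour_pair_rename[OF bal refl h(2) 3 a], of "2 * a" "b - a" c])
        (use 3 h(2) in \<open>simp_all add: pour_odd_pair_def odd\<close>)
  qed
qed

section \<open>Reduction to one odd vessel that is not the largest\<close>

abbreviation one_odd :: "nat \<Rightarrow> nat \<Rightarrow> nat \<Rightarrow> nat \<Rightarrow> bool" where
  "one_odd e a b c \<equiv> size (filter_mset (\<lambda>w. \<not> 2 ^ (e + 1) dvd w) {#a, b, c#}) = 1"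

text \<open>Exactness of \<open>e\<close> rules out zero odd vessels, so a count other than 2 and 3
  is 1. If all three are odd, pouring from C to B makes both \<open>(e+1)\<close>-even or empty
  while A stays odd; the extra \<open>L\<close> pays for this pouring.\<close>

lemma three_odd_step:
  assumes bal: "balanced (11 * L) a b c d e p" and a: "real a < T"
    and not_two: "card (odd_vessels (cfg a b c d e p False)) \<noteq> 2"
  shows "yields (if_do (\<lambda>s. card (odd_vessels s) = 3) (run [pour VC VB, rename]) (cfg a b c d e p False))
    (outcome finished (\<lambda>a b c d e' p. balanced (12 * L) a b c d e' p \<and> e' = e \<and> real a < T \<and> one_odd e' a b c))"
proof -
  note h = balancedD[OF bal]
  have pos: "0 < a" "0 < b" "0 < c" using h by auto
  note card = card_odd_vessels_cfg[OF pos, of d e p False]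
  show ?thesis
  proof (cases "card (odd_vessels (cfg a b c d e p False)) = 3")
    case False
    have "one_odd e a b c" using not_two False h(8) unfolding card by (auto split: if_splits)
    moreover have "balanced (12 * L) a b c d e p" using bal L_ge by (simp add: balanced_def)
    ultimately show ?thesis using False a by (simp add: if_do_def if_else_def outcomeI)
  next
    case True
    have odd: "\<not> 2 ^ (e + 1) dvd a" "\<not> 2 ^ (e + 1) dvd b" "\<not> 2 ^ (e + 1) dvd c"
      using True unfolding card by (auto split: if_splits)
    have ev: "2 ^ (e + 1) dvd c - b" "2 ^ (e + 1) dvd 2 * b"
      using dvd_odd_pair h odd by auto
    have adm: "admissible n {#a, 2 * b, c - b#} d e"
      using h(3-9) odd by (auto simp: admissible_def)
    have "yields (rename (cfg a (2 * b) (c - b) d e (p + 1) False))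
      (outcome finished (\<lambda>a b c d e' p. balanced (12 * L) a b c d e' p \<and> e' = e \<and> real a < T \<and> one_odd e' a b c))"
    proof (rule yields_rename[OF refl adm])
      show "real (p + 1) \<le> R + 40 * L * lg"
        using balanced_pourings_le[OF bal] L_lg lg_ge unfolding of_nat_add of_nat_1 by linarith
      fix m assume m: "0 < m" "m \<le> a" "m \<le> 2 * b" "m \<le> c - b"
      have "gain e a a \<le> gain e m a + real 0" using h(1) m by (intro gain_mono) auto
      moreover have "gain e a b \<le> 0" "gain e a c \<le> 0" using gain_odd pos odd by auto
      moreover have "0 \<le> gain e m (2 * b)" "0 \<le> gain e m (c - b)"
        using m h(6,7) by (auto intro!: gain_nonneg)
      ultimately show "real (p + 1) \<le> R + 20 * L * real e + 12 * L +
        (gain e m a + gain e m (2 * b) + gain e m (c - b))"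
        using h(10) L_ge by simp
    next
      fix x y z assume *: "balanced (12 * L) x y z d e (p + 1)" "{#x, y, z#} = {#a, 2 * b, c - b#}" "x \<le> a"
      have "one_odd e x y z" unfolding *(2) using odd ev by simp
      then show "balanced (12 * L) x y z d e (p + 1) \<and> e = e \<and> real x < T \<and> one_odd e x y z"
        using * a by simp
    qed
    then show ?thesis using True h(3) by (auto simp: if_do_def if_else_def run.simps(2) yields_def)
  qed
qed

text \<open>The loop ends because C loses at least \<open>b > 0\<close> each time. The two bounds
  say that the subtraction is exact and that C ends below B.\<close>

lemma while_pour_CB:
  assumes "0 < b"
  shows "\<exists>k. while_do (\<lambda>c. \<not> content c VC < content c VB) (pour VC VB) (cfg a b c d e p False) =
      Some (cfg a (2 ^ k * b) (c - (2 ^ k - 1) * b) d e (p + k) False) \<and>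
      (2 ^ k - 1) * b \<le> c \<and> c < 2 ^ k * b + (2 ^ k - 1) * b"
  using assms
proof (induction c arbitrary: b p rule: less_induct)
  case (less c)
  show ?case
  proof (cases "c < b")
    case True
    then show ?thesis by (intro exI[of _ 0]) (simp add: while_do.simps)
  next
    case False
    then obtain k where k: "while_do (\<lambda>c. \<not> content c VC < content c VB) (pour VC VB)
        (cfg a (2 * b) (c - b) d e (Suc p) False) =
      Some (cfg a (2 ^ k * (2 * b)) (c - b - (2 ^ k - 1) * (2 * b)) d e (Suc p + k) False)"
      "(2 ^ k - 1) * (2 * b) \<le> c - b" "c - b < 2 ^ k * (2 * b) + (2 ^ k - 1) * (2 * b)"
      using less.IH[of "c - b" "2 * b" "Suc p"] less.prems by auto
    define y :: nat where "y = 2 ^ k - 1"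
    have y: "2 ^ k = y + 1" by (simp add: y_def)
    then have y': "2 ^ Suc k = 2 * y + 2" by simp
    have "while_do (\<lambda>c. \<not> content c VC < content c VB) (pour VC VB) (cfg a b c d e p False) =
      while_do (\<lambda>c. \<not> content c VC < content c VB) (pour VC VB) (cfg a (2 * b) (c - b) d e (Suc p) False)"
      using False by (subst while_do.simps) simp
    moreover have "c - b - y * (2 * b) = c - (2 * y + 1) * b" "(2 * y + 1) * b \<le> c"
      "c < (2 * y + 2) * b + (2 * y + 1) * b"
      using k(2,3) False unfolding y by (simp_all add: algebra_simps)
    ultimately show ?thesis
      using k(1) unfolding y by (intro exI[of _ "Suc k"], unfold y') (simp add: algebra_simps)
  qed
qed

text \<open>Multiples of an \<open>(e+1)\<close>-even \<open>b\<close> are removed from C, so C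
  stays odd, hence nonempty, and the algorithm cannot stop here. The gain of B grows by the number
  \<open>k\<close> of pourings, so the debt is unchanged.\<close>

lemma drain_C_step:
  assumes bal: "balanced (12 * L) a b c d e p" and a: "real a < T" and one: "one_odd e a b c"
  shows "yields (if_do (\<lambda>s. VC \<in> odd_vessels s)
      (run [while_do (\<lambda>s. \<not> content s VC < content s VB) (pour VC VB), rename]) (cfg a b c d e p False))
    (outcome finished (\<lambda>a b c d e' p. balanced (12 * L) a b c d e' p \<and> e' = e \<and> real a < T \<and>
      one_odd e' a b c \<and> 2 ^ (e' + 1) dvd c))"
    (is "yields _ (outcome finished ?\<Phi>)")
proof -
  note h = balancedD[OF bal]
  have pos: "0 < a" "0 < b" "0 < c" using h by auto
  note odd = in_odd_vessels_cfg[OF pos, of d e p False]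
  show ?thesis
  proof (cases "2 ^ (e + 1) dvd c")
    case True
    then show ?thesis using odd(3) bal a one by (simp add: if_do_def if_else_def outcomeI)
  next
    case False
    have ev: "2 ^ (e + 1) dvd a" "2 ^ (e + 1) dvd b" using one False by (auto split: if_splits)
    obtain k where k: "while_do (\<lambda>c. \<not> content c VC < content c VB) (pour VC VB) (cfg a b c d e p False) =
        Some (cfg a (2 ^ k * b) (c - (2 ^ k - 1) * b) d e (p + k) False)"
      "(2 ^ k - 1) * b \<le> c" "c < 2 ^ k * b + (2 ^ k - 1) * b"
      using while_pour_CB[OF pos(2)] by blast
    define b' c' where "b' = 2 ^ k * b" and "c' = c - (2 ^ k - 1) * b"
    have c: "c = c' + (2 ^ k - 1) * b" using k(2) by (simp add: c'_def)
    have lt: "c' < b'" using k(2,3) unfolding b'_def c'_def by linarith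
    have "2 ^ (e + 1) dvd (2 ^ k - 1) * b" using ev(2) by (rule dvd_mult)
    then have odd': "\<not> 2 ^ (e + 1) dvd c'" using False unfolding c by (metis dvd_add)
    have ev': "2 ^ (e + 1) dvd b'" using ev(2) unfolding b'_def by (rule dvd_mult)
    have e': "2 ^ e dvd c'" "2 ^ e dvd b'" unfolding c'_def b'_def using h(6,7) by simp_all
    have "(2 ^ k :: nat) = 2 ^ k - 1 + 1" by simp
    then have "b' = (2 ^ k - 1) * b + b" unfolding b'_def by (metis add_mult_distrib mult_1)
    then have "a + b' + c' + d = n" using h(4) c by simp
    then have adm: "admissible n {#a, b', c'#} d e"
      using h(5,9) e' odd' by (auto simp: admissible_def add.assoc)
    have "yields (rename (cfg a b' c' d e (p + k) False)) (outcome finished ?\<Phi>)"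
    proof (rule yields_rename[OF refl adm])
      assume "a = 0 \<or> b' = 0 \<or> c' = 0"
      then show "real (p + k) \<le> R + 40 * L * lg"
        using pos odd' by (auto simp: b'_def)
    next
      fix m assume m: "0 < m" "m \<le> a" "m \<le> b'" "m \<le> c'"
      have "gain e a a \<le> gain e m a + real 0" "gain e a b \<le> gain e m b + real 0"
        using h(1) m by (auto intro!: gain_mono simp del: of_nat_0)
      moreover have "gain e m b' = gain e m b + real k" unfolding b'_def by (rule gain_mult[OF pos(2)])
      moreover have "gain e a c \<le> 0" using gain_odd pos False by auto
      moreover have "0 \<le> gain e m c'" using m e' by (auto intro!: gain_nonneg)
      ultimately show "real (p + k) \<le> R + 20 * L * real e + 12 * L + (gain e m a + gain e m b' + gain e m c')"
        using h(10) by simp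
    next
      fix x y z assume *: "balanced (12 * L) x y z d e (p + k)" "{#x, y, z#} = {#a, b', c'#}" "x \<le> a"
      have one': "one_odd e x y z" unfolding *(2) using odd' ev ev' by simp
      have "z = a \<or> z = b' \<or> z = c'" "b' = x \<or> b' = y \<or> b' = z" using set_eq3[OF *(2)] by auto
      then have "2 ^ (e + 1) dvd z" using lt ev ev' balancedD(2,3)[OF *(1)] by auto
      then show "balanced (12 * L) x y z d e (p + k) \<and> e = e \<and> real x < T \<and>
          one_odd e x y z \<and> 2 ^ (e + 1) dvd z"
        using * a one' by simp
    qed
    then show ?thesis
      using False odd(3) k(1) by (auto simp: if_do_def if_else_def run.simps(2) b'_def c'_def yields_def)
  qed
qed

section \<open>Pouring from the pool\<close>

text \<open>Applied to a content after its pool pourings, this shows that the new \<open>e\<close>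
  is at most \<open>lg\<close>, so that the reserve in \<open>admissible\<close> covers these
  pourings.\<close>

lemma evenness_Suc_le:
  assumes "2 ^ k dvd w" "0 < w" "real w < 2 * T"
  shows "real k \<le> lg"
proof -
  have "2 ^ k \<le> w" using assms by (simp add: dvd_imp_le)
  then have "(2 :: real) ^ k \<le> real w" using of_nat_mono[of "2 ^ k" w, where 'a = real] by simp
  then have "(2 :: real) ^ k \<le> real n" using assms(3) T_le by simp
  then show ?thesis using n_ge by (simp add: le_log_iff powr_realpow)
qed

text \<open>Steps (iii) and (v) are the same with \<open>u\<close> as B or A. The pouring takes less
  than \<open>T\<close> from the pool, and the required reserve drops by \<open>T\<close> as
  \<open>e\<close> grows by 1.\<close>

lemma pour_from_pool:
  assumes bal: "balanced (12 * L) a b c d e p" and perm: "{#u, v, w#} = {#a, b, c#}"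
    and odd: "\<not> 2 ^ (e + 1) dvd u" and even: "2 ^ (e + 1) dvd v" "2 ^ (e + 1) dvd w"
    and u: "real u < T" and perm': "{#a', b', c'#} = {#2 * u, v, w#}"
  shows "u \<le> d" "yields (rename (cfg a' b' c' (d - u) (e + 1) (p + 1) st)) (outcome finished (advanced e))"
proof -
  note h = balancedD[OF bal] and q = balanced_perm[OF bal perm]
  have "real (e + 1) \<le> lg" using q(1,8) u by (intro evenness_Suc_le[of _ "2 * u"]) auto
  then have "T * 1 \<le> T * (lg - real e)" using T_pos by (intro mult_left_mono) auto
  then show ud: "u \<le> d" using u h(9) by linarith
  have "T * (lg - real (e + 1)) = T * (lg - real e) - T" by (simp add: algebra_simps)
  then have "T * (lg - real (e + 1)) \<le> real (d - u)" using ud u h(9) by simp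
  then have adm: "admissible n {#2 * u, v, w#} (d - u) (e + 1)"
    using q(7,8) ud odd even by (auto simp: admissible_def)
  have a: "real a < T" using u q(4) by linarith
  show "yields (rename (cfg a' b' c' (d - u) (e + 1) (p + 1) st)) (outcome finished (advanced e))"
  proof (rule yields_rename[OF perm' adm])
    show "real (p + 1) \<le> R + 40 * L * lg" if "2 * u = 0 \<or> v = 0 \<or> w = 0" using that q by simp
    have "a = u \<or> a = v \<or> a = w" using set_eq3[OF perm] by auto
    then have min: "m \<le> 2 * a" if "m \<le> 2 * u" "m \<le> v" "m \<le> w" for m using that by auto
    fix m assume m: "m \<le> 2 * u" "m \<le> v" "m \<le> w"
    {
      assume "0 < m"
      then have "gain e a v \<le> gain (e + 1) m v + real 1" "gain e a w \<le> gain (e + 1) m w + real 1"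
        using gain_mono[OF h(1) \<open>0 < m\<close>, where i = 1 and e = e and e' = "e + 1"] min[OF m] by simp_all
      moreover have "gain e a u \<le> 0" using gain_odd q odd by auto
      moreover have "0 \<le> gain (e + 1) m (2 * u)" using \<open>0 < m\<close> m q(8) by (auto intro!: gain_nonneg)
      moreover have "20 * L * real (e + 1) = 20 * L * real e + 20 * L" by (simp add: algebra_simps)
      ultimately show "real (p + 1) \<le> R + 20 * L * real (e + 1) + 0 +
          (gain (e + 1) m (2 * u) + gain (e + 1) m v + gain (e + 1) m w)"
        using q(11) L_ge unfolding of_nat_add of_nat_1 by linarith
    }
    show "advanced e m y z (d - u) (e + 1) (p + 1)" if "balanced 0 m y z (d - u) (e + 1) (p + 1)" for y z
      using that min[OF m] a by (simp add: advanced_def)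
  qed
qed

section \<open>The long step\<close>

text \<open>The bound \<open>t \<le> tc\<close> keeps C divisible by \<open>2 ^ (e + t)\<close>. The
  bound through \<open>ta / 2\<close> keeps \<open>2 ^ (2 * t - 2) * a\<close> below
  \<open>T\<close>, so B suffices for the first pourings and the pool for the last ones. Only the
  remainder \<open>r\<close> is not divisible by \<open>2 ^ (e + t)\<close>, and \<open>t\<close>
  doublings repair this.\<close>

lemma long_step_advances:
  assumes bal: "balanced (12 * L) a b c d e p" and aT: "real a < T" and bT: "T \<le> real b"
    and ev: "2 ^ (e + 1) dvd a" "2 ^ (e + 1) dvd c" and odd: "\<not> 2 ^ (e + 1) dvd b"
  shows "yields (long_step n (cfg a b c d e p False)) (outcome finished (advanced e))"
proof -
  note h = balancedD[OF bal]
  have pos: "0 < a" "0 < b" "0 < c" using h by auto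
  define ta where "ta = log 2 (T / real a)"
  define tc where "tc = multiplicity 2 c - e"
  define t where "t = nat (max (min \<lceil>ta / 2\<rceil> (int tc)) 1)"
  have mc: "e + 1 \<le> multiplicity 2 c" using ev(2) le_multiplicity_2[OF pos(3)] by blast
  then have "(THE t. exactly_even (e + t) c) = tc"
    by (intro the_equality) (auto simp: exactly_even_iff[OF pos(3)] tc_def)
  then have long: "long_step n (cfg a b c d e p False) =
    run (replicate (t - 1) (pour VB VA) @ [janson_round, rename] @
             replicate t (pour VD VA) @ [increase_evenness t, rename]) (cfg a b c d e p False)"
    by (simp add: long_step_def Let_def ta_def t_def)
  \<comment> \<open>As C is \<open>(e+1)\<close>-even, \<open>tc\<close> is at least 1, so the
    maximum with 1 in \<open>t\<close> respects \<open>t \<le> tc\<close>.\<close>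
  have t: "1 \<le> t" "t \<le> tc" "t = tc \<or> ta / 2 \<le> real t" "real t < ta / 2 + 1 \<or> t = 1"
    using mc by (auto simp: t_def tc_def min_def max_def split: if_splits) linarith+
  define y :: nat where "y = 2 ^ (t - 1)"
  have y: "0 < y" "2 ^ t = 2 * y" unfolding y_def using t(1) by (simp_all flip: power_Suc)
  have ayy: "real (a * y * y) < T"
  proof (cases "t = 1")
    case False
    then have "real (2 * (t - 1)) < log 2 (T / real a)" using t(1,4) by (simp add: ta_def of_nat_diff)
    then have "2 powr real (2 * (t - 1)) < T / real a"
      using T_pos pos by (subst (asm) less_log_iff) auto
    then have "2 ^ (2 * (t - 1)) < T / real a" by (subst (asm) powr_realpow) auto
    then have "real y * real y < T / real a" by (simp add: y_def power_mult power2_eq_square power_mult_distrib flip: power_add mult_2)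
    then show ?thesis using pos by (simp add: field_simps)
  qed (use aT in \<open>simp add: y_def\<close>)
  \<comment> \<open>B gives away \<open>y - 1\<close> units of \<open>a\<close> and must still hold
    \<open>y\<close> of them for the Janson round; this is covered since \<open>y * y\<close> units
    are below \<open>T \<le> b\<close>.\<close>
  have "2 * y - 1 \<le> y * y"
  proof -
    obtain z where "y = Suc z" using y(1) gr0_implies_Suc by blast
    then show ?thesis by simp
  qed
  then have "a * (2 * y - 1) \<le> a * y * y" unfolding mult.assoc by (rule mult_le_mono2)
  then have "real (a * (2 * y - 1)) \<le> real (a * y * y)" by (rule of_nat_mono)
  then have "a * (2 * y - 1) < b" using ayy bT by linarith
  moreover have "2 * y - 1 = (y - 1) + y" using y(1) by simp
  ultimately have ab: "a * (y - 1) + y * a < b" by (simp add: add_mult_distrib2 mult.commute)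
  define a1 b1 where "a1 = y * a" and "b1 = b - a * (y - 1)"
  have ab1: "0 < a1" "a1 \<le> b1" "b1 \<le> c" "b1 + a * (y - 1) = b"
    using ab pos y(1) h(3) by (auto simp: a1_def b1_def)
  define k where "k = floor_log2 (b1 div a1)"
  define r A2 C2 where "r = b1 mod a1" and "A2 = 2 ^ (k + 1) * a1"
    and "C2 = c - a1 * (2 ^ (k + 1) - 1 - b1 div a1)"
  note janson = janson_round_cfg[OF ab1(1-3), folded k_def, folded r_def A2_def C2_def]
  have A2: "A2 = 2 ^ (t + k) * a"
    using y(2) by (simp add: A2_def a1_def power_add)
  have a1_dvd: "2 ^ (e + t) dvd a1"
  proof -
    have "y * 2 ^ (e + 1) dvd y * a" using ev(1) by (intro mult_dvd_mono) auto
    moreover have "y * 2 ^ (e + 1) = 2 ^ (e + t)" using y(2) by (simp add: power_add)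
    ultimately show ?thesis unfolding a1_def by metis
  qed
  have "e + t \<le> multiplicity 2 c" using t(2) mc by (simp add: tc_def)
  then have c_dvd: "2 ^ (e + t) dvd c" using le_multiplicity_2[OF pos(3)] by blast
  have AC_dvd: "2 ^ (e + t) dvd A2" "2 ^ (e + t) dvd C2"
    using a1_dvd c_dvd by (auto simp: A2_def C2_def intro!: dvd_diff_nat)
  have "2 ^ (e + 1) dvd a1" using ev(1) by (simp add: a1_def)
  \<comment> \<open>\<open>r\<close> differs from \<open>b\<close> by a multiple of
    \<open>a\<close>, so it inherits oddness.\<close>
  then have r_odd: "\<not> 2 ^ (e + 1) dvd r"
    using odd ev(1) ab1(4) unfolding r_def by (metis dvd_add dvd_mod_iff dvd_mult2)
  have r_dvd: "2 ^ e dvd r"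
    using h(5,6) unfolding r_def b1_def a1_def by (intro dvd_mod dvd_diff_nat) auto
  have r0: "0 < r" using r_odd by (cases r) auto
  have r_lt: "r < a1" "r < A2" "r < C2"
  proof -
    show "r < a1" using ab1(1) by (simp add: r_def)
    moreover have "a1 \<le> A2" by (simp add: A2_def)
    ultimately show "r < A2" by simp
    show "r < C2" using janson(2) ab1(1) unfolding r_def C2_def by linarith
  qed
  have "A2 + r + C2 + d = n"
  proof -
    define q z where "q = b1 div a1" and "z = 2 ^ (k + 1) - 1 - q"
    have "0 < q" using ab1 by (simp add: q_def div_greater_zero_iff)
    then have "2 ^ (k + 1) = z + 1 + q"
      using floor_log2_bounds(2)[of q] by (simp add: k_def q_def z_def)
    then have "A2 = a1 * z + a1 + a1 * q" by (simp add: A2_def algebra_simps)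
    moreover have "a1 * q + r = b1" by (simp add: q_def r_def)
    moreover have "C2 + a1 * z = c" using janson(2) unfolding C2_def z_def q_def by linarith
    moreover have "a1 = a + a * (y - 1)"
      using y(1) by (cases y) (simp_all add: a1_def)
    ultimately show ?thesis using h(4) ab1(4) by linarith
  qed
  have r2t: "real (2 ^ t * r) < 2 * T" "2 ^ t * r \<le> 2 ^ (2 * t) * a"
  proof -
    have "2 ^ t * r \<le> 2 * y * (y * a)" unfolding y(2) using r_lt(1) by (simp add: a1_def)
    then have le: "2 ^ t * r \<le> 2 * (a * y * y)" by (simp add: mult_ac)
    have "real (2 ^ t * r) \<le> 2 * real (a * y * y)" using of_nat_mono[OF le, where 'a = real] by simp
    then show "real (2 ^ t * r) < 2 * T" using ayy by linarith
    have "(2 :: nat) ^ (2 * t) = (2 * y) * (2 * y)" unfolding y(2)[symmetric] by (simp add: power_add mult_2)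
    then show "2 ^ t * r \<le> 2 ^ (2 * t) * a" using le by (simp add: mult_ac)
  qed
  have "real (e + t) \<le> lg"
    using r2t(1) r0 r_dvd by (intro evenness_Suc_le[of _ "2 ^ t * r"]) (auto simp: power_add mult.commute mult_dvd_mono)
  then have "T * real t \<le> T * (lg - real e)" using T_pos by (intro mult_left_mono) auto
  \<comment> \<open>A single pouring costs \<open>r < a < T\<close>; for \<open>t \<ge> 2\<close>
    the total is below \<open>2 * T \<le> T * t\<close>.\<close>
  moreover have pool: "real (r * (2 ^ t - 1)) \<le> T * real t"
  proof (cases "t = 1")
    case True
    then show ?thesis using r_lt(1) aT by (simp add: a1_def y_def)
  next
    case False
    have "real (r * (2 ^ t - 1)) \<le> real (2 ^ t * r)"
      by (intro of_nat_mono) (simp add: mult.commute)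
    also have "\<dots> \<le> T * 2" using r2t(1) by simp
    also have "\<dots> \<le> T * real t" using False t(1) T_pos by (intro mult_left_mono) auto
    finally show ?thesis .
  qed
  ultimately have "real (r * (2 ^ t - 1)) \<le> real d" using h(9) by linarith
  then have rd: "r * (2 ^ t - 1) \<le> d" by linarith
  define d' where "d' = d - r * (2 ^ t - 1)"
  have "2 ^ t * r = r * (2 ^ t - 1) + r"
    by (cases "2 ^ t :: nat") (simp_all add: algebra_simps)
  then have sum: "2 ^ t * r + (A2 + C2) + d' = n" using \<open>A2 + r + C2 + d = n\<close> rd by (simp add: d'_def)
  have "T * (lg - real (e + t)) = T * (lg - real e) - T * real t" by (simp add: algebra_simps)
  then have "T * (lg - real (e + t)) \<le> real d'"
    using pool h(9) rd by (simp only: d'_def of_nat_diff)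
  moreover have "\<not> 2 ^ (e + t + 1) dvd 2 ^ t * r"
  proof
    assume "2 ^ (e + t + 1) dvd 2 ^ t * r"
    then have "2 ^ t * 2 ^ (e + 1) dvd 2 ^ t * r" by (simp add: power_add mult_ac)
    then show False using r_odd by simp
  qed
  moreover have "2 ^ (e + t) dvd 2 ^ t * r" using r_dvd by (simp add: power_add mult.commute mult_dvd_mono)
  ultimately have adm: "admissible n {#2 ^ t * r, A2, C2#} d' (e + t)"
    using AC_dvd sum by (simp add: admissible_def)
  define p1 where "p1 = p + (t - 1) + (k + 1)"
  obtain x u v where rn: "rename (cfg A2 r C2 d e p1 False) = Some (cfg x u v d e p1 (x = 0))"
    "x \<le> u" "u \<le> v" "{#x, u, v#} = {#A2, r, C2#}"
    using rename_cfg by blast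
  \<comment> \<open>The odd remainder is the strict minimum, so the pool pours go to it and not to \<open>C\<close>.\<close>
  have "r \<in> {x, u, v}" "x \<in> {A2, r, C2}" using set_eq3[OF rn(4)] by auto
  then have "x = r" using rn(2,3) r_lt by auto
  then have perm: "{#2 ^ t * r, u, v#} = {#2 ^ t * r, A2, C2#}" using rn(4) by (simp add: add_mset_commute)
  have fin: "yields (rename (cfg (2 ^ t * r) u v d' (e + t) (p1 + t) False)) (outcome finished (advanced e))"
  proof (rule yields_rename[OF perm adm])
    show "real (p1 + t) \<le> R + 40 * L * lg" if "2 ^ t * r = 0 \<or> A2 = 0 \<or> C2 = 0" using that r_lt r0 by auto
    fix m assume m: "m \<le> 2 ^ t * r" "m \<le> A2" "m \<le> C2"
    {
      assume "0 < m"
      \<comment> \<open>The base grows at most to \<open>2 ^ (2 * t) * a\<close> and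
        \<open>e\<close> by \<open>t\<close>, so the gain of \<open>a\<close> drops by at most
        \<open>2 * t\<close>, while the factor \<open>2 ^ (t + k)\<close> in \<open>A2\<close>
        returns \<open>t + k\<close>. The net \<open>k - t\<close> goes towards the Janson
        round.\<close>
      have "gain e a a \<le> gain (e + t) m a + real (2 * t)"
        using pos \<open>0 < m\<close> m(1) r2t(2) by (intro gain_mono) auto
      moreover have "0 \<le> gain e a a" using h(5) pos by (intro gain_nonneg) auto
      moreover have "gain (e + t) m A2 = gain (e + t) m a + real (t + k)"
        unfolding A2 by (rule gain_mult[OF pos(1)])
      moreover have "0 \<le> gain (e + t) m (2 ^ t * r)" "0 \<le> gain (e + t) m C2"
        using \<open>0 < m\<close> m AC_dvd \<open>2 ^ (e + t) dvd 2 ^ t * r\<close> by (auto intro!: gain_nonneg)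
      ultimately have after: "real k \<le> real t +
        (gain (e + t) m (2 ^ t * r) + gain (e + t) m A2 + gain (e + t) m C2)" by simp
      have before: "gain e a c \<le> 2 * real t + L + 2"
      proof (cases "t = tc")
        case True
        then have "real (multiplicity 2 c) - real e = real t" using mc by (simp add: tc_def of_nat_diff)
        then have "gain e a c \<le> real t" by (simp add: gain_def)
        then show ?thesis using L_ge by linarith
      next
        case False
        then have "log 2 T - log 2 (real a) \<le> 2 * real t" using t(3) T_pos pos by (simp add: ta_def log_divide)
        moreover have "log 2 (real c) \<le> lg" using pos h(4) by simp
        ultimately show ?thesis using gain_le_log[OF pos(1), of e c] log_n_T by linarith
      qed
      \<comment> \<open>The total: debt \<open>12 * L\<close>, lost gain
        \<open>2 * t + L + 2\<close> of C, \<open>2 * t\<close> pourings apart from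
        \<open>k\<close>, and \<open>t\<close> for the unpaid part of \<open>k\<close>. These
        \<open>13 * L + 5 * t + 2\<close> are at most \<open>20 * (L * t)\<close>.\<close>
      have "gain e a b \<le> 0" "gain e a a \<le> 0" using gain_odd[OF pos(2) odd] gain_self by auto
      moreover have "20 * L * real (e + t) = 20 * L * real e + 20 * (L * real t)" by (simp add: algebra_simps)
      moreover have "real t \<le> L * real t" "L \<le> L * real t"
        using mult_right_mono[OF L_ge, of "real t"] mult_left_mono[of 1 "real t" L] t(1) L_ge by auto
      moreover have "real (p1 + t) = real p + 2 * real t + real k" using t(1) by (simp add: p1_def)
      ultimately show "real (p1 + t) \<le> R + 20 * L * real (e + t) + 0 +
          (gain (e + t) m (2 ^ t * r) + gain (e + t) m A2 + gain (e + t) m C2)"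
        using after before h(10) L_ge t(1) by linarith
    }
    have "real m \<le> real (2 ^ t * r)" using m(1) by (rule of_nat_mono)
    then show "advanced e m y' z d' (e + t) (p1 + t)" if "balanced 0 m y' z d' (e + t) (p1 + t)" for y' z
      using that r2t(1) t(1) unfolding advanced_def by simp
  qed
  have pours: "run (replicate (t - 1) (pour VB VA)) (cfg a b c d e p False) =
      Some (cfg a1 b1 c d e (p + (t - 1)) False)"
    using replicate_pour_BA[of a "t - 1" b c d e p] ab by (simp add: a1_def b1_def y_def)
  have pool_pours: "run (replicate t (pour VD VA)) (cfg r u v d e p1 False) =
      Some (cfg (2 ^ t * r) u v d' e (p1 + t) False)"
    using replicate_pour_DA[OF rd] by (simp add: d'_def)
  show ?thesis
    using fin r0 unfolding long
    by (simp add: run_append pours run.simps(2) janson(1)[of d e "p + (t - 1)"] p1_def[symmetric]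
      rn(1)[unfolded \<open>x = r\<close>] pool_pours del: One_nat_def)
qed

text \<open>The single odd vessel is A or B, so one of the branches applies and \<open>e\<close>
  grows.\<close>

lemma final_step:
  assumes bal: "balanced (12 * L) a b c d e p" and aT: "real a < T"
    and one: "one_odd e a b c" and c: "2 ^ (e + 1) dvd c"
  shows "yields (if_else (\<lambda>s. VB \<in> odd_vessels s \<and> real (content s VB) < T)
            (run [pour VD VB, increase_evenness 1, rename])
            (if_else (\<lambda>s. VB \<in> odd_vessels s \<and> real (content s VB) \<ge> T)
              (long_step n)
              (if_do (\<lambda>s. VA \<in> odd_vessels s)
                (run [pour VD VA, increase_evenness 1, rename]))) (cfg a b c d e p False))
    (outcome finished (advanced e))"
proof -
  note h = balancedD[OF bal]
  have pos: "0 < a" "0 < b" "0 < c" using h by auto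
  note odd = in_odd_vessels_cfg[OF pos, of d e p False]
  consider "2 ^ (e + 1) dvd a" "\<not> 2 ^ (e + 1) dvd b" "real b < T"
    | "2 ^ (e + 1) dvd a" "\<not> 2 ^ (e + 1) dvd b" "T \<le> real b"
    | "\<not> 2 ^ (e + 1) dvd a" "2 ^ (e + 1) dvd b"
    using one c by (force split: if_splits)
  then show ?thesis
  proof cases
    case 1
    have perm: "{#b, a, c#} = {#a, b, c#}" "{#a, 2 * b, c#} = {#2 * b, a, c#}"
      by (simp_all add: add_mset_commute)
    note q = pour_from_pool[OF bal perm(1) 1(2,1) c 1(3) perm(2)]
    have "yields (run [pour VD VB, increase_evenness 1, rename] (cfg a b c d e p False))
      (outcome finished (advanced e))"
      using q(1) q(2)[of False] by (simp add: run.simps(2))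
    then show ?thesis using 1 odd by (simp add: yields_if_else)
  next
    case 2
    then show ?thesis using odd long_step_advances[OF bal aT 2(3,1) c 2(2)] by (simp add: yields_if_else)
  next
    case 3
    note q = pour_from_pool[OF bal refl 3 c aT refl]
    have "yields (run [pour VD VA, increase_evenness 1, rename] (cfg a b c d e p False))
      (outcome finished (advanced e))"
      using q(1) q(2)[of False] by (simp add: run.simps(2))
    then show ?thesis using 3 odd by (simp add: yields_if_else if_do_def)
  qed
qed

section \<open>Frei rounds with minimum at least \<open>T\<close>\<close>

lemma frei_cost:
  assumes "0 < a" "a \<le> b" "b \<le> n" "T \<le> real a" "real k \<le> log 2 (real b / real a) + 2"
  shows "real k \<le> L + 4"
proof -
  have "log 2 (real b / real a) = log 2 (real b) - log 2 (real a)" using assms by (simp add: log_divide)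
  moreover have "log 2 (real b) \<le> lg" "log 2 T \<le> log 2 (real a)" using assms T_pos by simp_all
  ultimately show ?thesis using log_n_T assms(5) by linarith
qed

text \<open>The potential before a Frei round is written off, and the one after it is only used as
  nonnegative. The renaming is kept apart because the round may empty a vessel.\<close>

lemma frei_step:
  assumes bal: "balanced 0 a b c d e p" and a: "real a < 2 * T"
  obtains a' b' c' e' p' where
    "if_do (\<lambda>s. real (content s VA) \<ge> T) (run [frei_round, set_evenness]) (cfg a b c d e p False) =
      Some (cfg a' b' c' d e' p' False)"
    "yields (rename (cfg a' b' c' d e' p' False))
      (outcome finished (\<lambda>a b c d e' p. balanced (11 * L) a b c d e' p \<and> e \<le> e' \<and> real a < T))"
proof -
  note h = balancedD[OF bal]
  let ?\<Phi> = "\<lambda>a b c d e' p. balanced (11 * L) a b c d e' p \<and> e \<le> e' \<and> real a < T"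
  show thesis
  proof (cases "T \<le> real a")
    case False
    have "yields (rename (cfg a b c d e p False)) (outcome finished ?\<Phi>)"
    proof (rule yields_rename[OF refl])
      show "admissible n {#a, b, c#} d e" using bal by (simp add: balanced_def)
      show "real p \<le> R + 40 * L * lg" if "a = 0 \<or> b = 0 \<or> c = 0" using that h by auto
      fix m assume m: "m \<le> a" "m \<le> b" "m \<le> c"
      show "real p \<le> R + 20 * L * real e + 11 * L + (gain e m a + gain e m b + gain e m c)" if "0 < m"
      proof -
        have "gain e a w \<le> gain e m w + real 0" for w
          using h(1) that m(1) by (intro gain_mono) auto
        from this[of a] this[of b] this[of c] show ?thesis using h(10) L_ge by simp
      qed
      show "?\<Phi> m y z d e p" if "balanced (11 * L) m y z d e p" for y z
        using that m False by simp
    qed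
    then show thesis using False by (intro that[of a b c e p]) (simp_all add: if_do_def if_else_def)
  next
    case True
    obtain a' b' c' k where f: "frei_round (cfg a b c d e p False) = Some (cfg a' b' c' d e (p + k) False)"
      "a' + b' + c' = a + b + c" "2 * min a' b' \<le> a" "real k \<le> log 2 (real b / real a) + 2"
      "\<And>f. f dvd a \<Longrightarrow> f dvd b \<Longrightarrow> f dvd c \<Longrightarrow> f dvd a' \<and> f dvd b' \<and> f dvd c'"
      using frei_round_cfg[OF h(1-3)] by blast
    have k: "real k \<le> L + 4" using frei_cost[OF h(1,2) _ True f(4)] h(4) by simp
    obtain e' where s: "set_evenness (cfg a' b' c' d e (p + k) False) = Some (cfg a' b' c' d e' (p + k) False)"
      "2 ^ e' dvd a'" "2 ^ e' dvd b'" "2 ^ e' dvd c'"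
      "\<not> (2 ^ (e' + 1) dvd a' \<and> 2 ^ (e' + 1) dvd b' \<and> 2 ^ (e' + 1) dvd c')"
      "\<And>k. 2 ^ k dvd a' \<Longrightarrow> 2 ^ k dvd b' \<Longrightarrow> 2 ^ k dvd c' \<Longrightarrow> k \<le> e'"
      using set_evenness_cfg[of a' b' c' d e "p + k" False] f(2) h(1) by auto
    have e: "e \<le> e'" using s(6) f(5)[OF h(5-7)] by blast
    have "T * (lg - real e') \<le> T * (lg - real e)" using e T_pos by simp
    then have adm: "admissible n {#a', b', c'#} d e'"
      using s(2-5) f(2) h(4,9) by (auto simp: admissible_def)
    have "gain e a w \<le> L + 2" if "0 < w" "w \<le> n" for w
    proof -
      have "log 2 (real w) \<le> lg" "log 2 T \<le> log 2 (real a)" using that True T_pos by simp_all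
      then show ?thesis using gain_le_log[OF h(1), of e w] log_n_T by linarith
    qed
    from this[of b] this[of c] have "gain e a b \<le> L + 2" "gain e a c \<le> L + 2" using h(1-4) by auto
    \<comment> \<open>At most \<open>L + 4\<close> pourings and two lost gains of at most
      \<open>L + 2\<close> each: \<open>3 * L + 8 \<le> 11 * L\<close>.\<close>
    then have cost: "real (p + k) \<le> R + 20 * L * real e + 11 * L"
      using h(10) gain_self[of e a] k L_ge by simp
    have mono: "x \<le> y \<Longrightarrow> 20 * L * x \<le> 20 * L * y" for x y using L_ge by (intro mult_left_mono) auto
    have "yields (rename (cfg a' b' c' d e' (p + k) False)) (outcome finished ?\<Phi>)"
    proof (rule yields_rename[OF refl adm])
      show "real (p + k) \<le> R + 40 * L * lg"
        using cost mono[OF evenness_le[OF bal]] L_lg L_ge by linarith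
      fix m assume m: "m \<le> a'" "m \<le> b'" "m \<le> c'"
      show "real (p + k) \<le> R + 20 * L * real e' + 11 * L + (gain e' m a' + gain e' m b' + gain e' m c')" if "0 < m"
        using cost mono[of "real e" "real e'"] e gain_nonneg[OF that m(1) s(2)]
          gain_nonneg[OF that m(2) s(3)] gain_nonneg[OF that m(3) s(4)] by linarith
      have "2 * m \<le> a" using m f(3) by linarith
      then show "?\<Phi> m y z d e' (p + k)" if "balanced (11 * L) m y z d e' (p + k)" for y z
        using that e a by simp
    qed
    then show thesis using True
      by (intro that[of a' b' c' e' "p + k"]) (simp_all add: if_do_def if_else_def run.simps(2) f(1) s(1))
  qed
qed

section \<open>The whole loop\<close>

lemma advanced_mono: "advanced e a b c d e' p \<Longrightarrow> e0 \<le> e \<Longrightarrow> advanced e0 a b c d e' p"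
  by (simp add: advanced_def)

lemma loop_body_advances:
  assumes bal: "balanced 0 a b c d e p" and a: "real a < 2 * T"
  shows "yields (loop_body n (cfg a b c d e p False)) (outcome finished (advanced e))"
proof -
  have branch: "yields (if_else (\<lambda>s. card (odd_vessels s) = 2) (run [pour_odd_pair, increase_evenness 1, rename])
       (run
         [if_do (\<lambda>c. card (odd_vessels c) = 3) (run [pour VC VB, rename]),
          if_do (\<lambda>c. VC \<in> odd_vessels c)
            (run [while_do (\<lambda>c. \<not> content c VC < content c VB) (pour VC VB), rename]),
          if_else (\<lambda>c. VB \<in> odd_vessels c \<and> real (content c VB) < threshold n)
            (run [pour VD VB, increase_evenness 1, rename])
            (if_else (\<lambda>c. VB \<in> odd_vessels c \<and> real (content c VB) \<ge> threshold n)
              (long_step n)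
              (if_do (\<lambda>c. VA \<in> odd_vessels c)
                (run [pour VD VA, increase_evenness 1, rename])))]) (cfg a b c d e p False))
    (outcome finished (advanced e))"
    if bal: "balanced (11 * L) a b c d e p" and a: "real a < T" for a b c d e p
  proof (cases "card (odd_vessels (cfg a b c d e p False)) = 2")
    case True
    then show ?thesis using pour_odd_pair_step[OF bal a] by (simp add: yields_if_else)
  next
    case False
    show ?thesis
      unfolding yields_if_else if_not_P[OF False]
    proof (rule outcome_run_Cons, rule three_odd_step[OF bal a False], elim conjE)
      fix a b c d e' p
      assume *: "balanced (12 * L) a b c d e' p" "e' = e" "real a < T" "one_odd e' a b c"
      show "yields (run
         [if_do (\<lambda>c. VC \<in> odd_vessels c)
            (run [while_do (\<lambda>c. \<not> content c VC < content c VB) (pour VC VB), rename]),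
          if_else (\<lambda>c. VB \<in> odd_vessels c \<and> real (content c VB) < threshold n)
            (run [pour VD VB, increase_evenness 1, rename])
            (if_else (\<lambda>c. VB \<in> odd_vessels c \<and> real (content c VB) \<ge> threshold n)
              (long_step n)
              (if_do (\<lambda>c. VA \<in> odd_vessels c)
                (run [pour VD VA, increase_evenness 1, rename])))] (cfg a b c d e' p False))
          (outcome finished (advanced e))"
        by (rule outcome_run_Cons, rule drain_C_step[OF *(1,3,4)], elim conjE,
          rule outcome_run_single, unfold *(2), hypsubst, rule final_step)
    qed
  qed
  obtain a' b' c' e' p' where f:
    "if_do (\<lambda>s. real (content s VA) \<ge> T) (run [frei_round, set_evenness]) (cfg a b c d e p False) =
      Some (cfg a' b' c' d e' p' False)"
    "yields (rename (cfg a' b' c' d e' p' False))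
      (outcome finished (\<lambda>a b c d e' p. balanced (11 * L) a b c d e' p \<and> e \<le> e' \<and> real a < T))"
    using frei_step[OF bal a] by blast
  show ?thesis
    unfolding loop_body_def
    by (subst yields_run_Cons, subst f(1), simp only: yields_Some cfg_sel if_False)
      (rule outcome_run_Cons, rule f(2), elim conjE,
        rule outcome_run_single, rule outcome_mono[OF branch], auto intro: advanced_mono)
qed

text \<open>A balanced running configuration satisfies the loop guard, so the loop can end only by a
  stop; it does, since \<open>e\<close> grows strictly and stays at most \<open>lg\<close>.\<close>

lemma loop_finishes:
  assumes "balanced 0 a b c d e p" "real a < 2 * T"
  shows "yields (while_do (\<lambda>s. Min {content s VA, content s VB, content s VC} > 0) (loop_body n)
    (cfg a b c d e p False)) finished"
  using assms
proof (induction "nat \<lfloor>lg\<rfloor> - e" arbitrary: a b c d e p rule: less_induct)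
  case less
  have pos: "0 < a" "0 < b" "0 < c" using balancedD(1-3)[OF less.prems(1)] by auto
  let ?W = "while_do (\<lambda>s. Min {content s VA, content s VB, content s VC} > 0) (loop_body n)"
  have "yields (Option.bind (loop_body n (cfg a b c d e p False)) ?W) finished"
    unfolding yields_bind
  proof (rule yields_mono[OF loop_body_advances[OF less.prems]])
    fix s assume "outcome finished (advanced e) s"
    then consider "stopped s" "finished s"
      | a b c d e' p where "s = cfg a b c d e' p False" "advanced e a b c d e' p"
      unfolding outcome_def by blast
    then show "yields (?W s) finished"
    proof cases
      case 1
      then show ?thesis by (subst while_do.simps) simp
    next
      case 2
      then have "real e' \<le> lg" using evenness_le unfolding advanced_def by blast
      then have "nat \<lfloor>lg\<rfloor> - e' < nat \<lfloor>lg\<rfloor> - e" using 2(2) unfolding advanced_def by linarith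
      then show ?thesis using less.hyps 2 unfolding advanced_def by simp
    qed
  qed
  then show ?case using pos by (subst while_do.simps) simp
qed

section \<open>The first phase\<close>

text \<open>While the loop runs, the minimum is at least \<open>2 * T\<close>, so a round costs at
  most \<open>L + 4\<close>; each round at least halves the minimum, hence at most \<open>j\<close>
  rounds occur.\<close>

lemma first_phase:
  assumes "w \<le> x" "x \<le> y" "y \<le> z" "w + x + y + z = n" "real w < 2 * T * 2 ^ j"
  shows "\<exists>w' x' y' z' p'. while_do (\<lambda>s. \<not> real (content s VA) < real n / (2 * lg)) (run [frei_round, order_ABCD])
      (cfg w x y z e p False) = Some (cfg w' x' y' z' e p' False) \<and>
    w' \<le> x' \<and> x' \<le> y' \<and> y' \<le> z' \<and> w' + x' + y' + z' = n \<and> real w' < 2 * T \<and>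
    real p' \<le> real p + (L + 4) * real j"
  using assms
proof (induction j arbitrary: w x y z p)
  case 0
  then have "real w < real n / (2 * lg)" by (simp add: threshold_def)
  then have "while_do (\<lambda>s. \<not> real (content s VA) < real n / (2 * lg)) (run [frei_round, order_ABCD])
      (cfg w x y z e p False) = Some (cfg w x y z e p False)"
    by (subst while_do.simps) simp
  moreover have "real w < 2 * T" "real p \<le> real p + (L + 4) * real 0" using 0 by simp_all
  ultimately show ?case using 0(1-4) by blast
next
  case (Suc j)
  let ?W = "while_do (\<lambda>s. \<not> real (content s VA) < real n / (2 * lg)) (run [frei_round, order_ABCD])"
  have guard: "real n / (2 * lg) = 2 * T" by (simp add: threshold_def)
  show ?case
  proof (cases "real w < 2 * T")
    case True
    then have "?W (cfg w x y z e p False) = Some (cfg w x y z e p False)"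
      unfolding guard by (subst while_do.simps) simp
    moreover have "0 \<le> (L + 4) * real (Suc j)" using L_ge by (intro mult_nonneg_nonneg) linarith+
    then have "real p \<le> real p + (L + 4) * real (Suc j)" by linarith
    ultimately show ?thesis using Suc.prems(1-4) True by blast
  next
    case False
    then have w: "0 < w" "T \<le> real w" using T_pos by (auto intro!: gr0I)
    obtain a b c k where f: "frei_round (cfg w x y z e p False) = Some (cfg a b c z e (p + k) False)"
      "a + b + c = w + x + y" "2 * min a b \<le> w" "real k \<le> log 2 (real x / real w) + 2"
      using frei_round_cfg[OF w(1) Suc.prems(1,2)] by metis
    obtain w' x' y' z' where o: "order_ABCD (cfg a b c z e (p + k) False) = Some (cfg w' x' y' z' e (p + k) False)"
      "w' \<le> x'" "x' \<le> y'" "y' \<le> z'" "{#w', x', y', z'#} = {#a, b, c, z#}"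
      using order_ABCD_cfg by metis
    have "a \<in> {w', x', y', z'}" "b \<in> {w', x', y', z'}" using set_eq4[OF o(5)] by auto
    then have "w' \<le> min a b" using o(2-4) by auto
    then have "2 * w' \<le> w" using f(3) by linarith
    then have "real w' < 2 * T * 2 ^ j" using Suc.prems(5) by simp
    moreover have "w' + x' + y' + z' = n" using sum_eq4[OF o(5)] f(2) Suc.prems(4) by simp
    ultimately obtain w1 x1 y1 z1 p1 where IH: "?W (cfg w' x' y' z' e (p + k) False) = Some (cfg w1 x1 y1 z1 e p1 False)"
      "w1 \<le> x1" "x1 \<le> y1" "y1 \<le> z1" "w1 + x1 + y1 + z1 = n" "real w1 < 2 * T"
      "real p1 \<le> real (p + k) + (L + 4) * real j"
      using Suc.IH[OF o(2-4)] by blast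
    have "real k \<le> L + 4" using frei_cost[OF w(1) Suc.prems(1) _ w(2) f(4)] Suc.prems(4) by simp
    then have "real p1 \<le> real p + (L + 4) * real (Suc j)" using IH(7) by (simp add: algebra_simps)
    moreover have "?W (cfg w x y z e p False) = ?W (cfg w' x' y' z' e (p + k) False)"
      using False by (subst while_do.simps) (simp add: guard run.simps(2) f(1) o(1))
    ultimately show ?thesis using IH(1-6) by (simp only:) blast
  qed
qed

section \<open>The complete run\<close>

lemma algorithm_finishes:
  assumes n: "n = a + b + c + d" and R: "(L + 4) * (L + 1) \<le> R"
  shows "yields (four_vessel_pouring a b c d) finished"
proof -
  obtain w x y z where o: "order_ABCD (cfg a b c d 0 0 False) = Some (cfg w x y z 0 0 False)"
    "w \<le> x" "x \<le> y" "y \<le> z" "{#w, x, y, z#} = {#a, b, c, d#}"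
    using order_ABCD_cfg by metis
  have sum: "w + x + y + z = n" using sum_eq4[OF o(5)] n by simp
  \<comment> \<open>The minimum is at most \<open>n / 4 = T * 2 powr L\<close>, so at most
    \<open>L + 1\<close> rounds of at most \<open>L + 4\<close> pourings are made.\<close>
  define j where "j = nat \<lceil>L\<rceil>"
  have j: "L \<le> real j" "real j \<le> L + 1" using L_ge unfolding j_def by linarith+
  have "lg = 2 powr L" using lg_ge by simp
  also have "\<dots> \<le> 2 powr real j" using j(1) by (intro powr_mono) auto
  also have "\<dots> = 2 ^ j" by (simp add: powr_realpow)
  finally have "T * lg \<le> T * 2 ^ j" using T_pos by (intro mult_left_mono) auto
  moreover have "0 < T * 2 ^ j" using T_pos by simp
  moreover have "real w \<le> T * lg" unfolding T_lg using o(2-4) sum by linarith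
  ultimately have "real w < 2 * T * 2 ^ j" by linarith
  from first_phase[OF o(2-4) sum this, of 0 0] obtain w1 x1 y1 z1 p1 where
    W: "while_do (\<lambda>s. \<not> real (content s VA) < real n / (2 * lg)) (run [frei_round, order_ABCD])
      (cfg w x y z 0 0 False) = Some (cfg w1 x1 y1 z1 0 p1 False)"
    and w1: "w1 \<le> x1" "x1 \<le> y1" "y1 \<le> z1" "w1 + x1 + y1 + z1 = n" "real w1 < 2 * T"
      "real p1 \<le> (L + 4) * real j"
    by auto
  obtain a' b' c' d' where o': "order_ABCD (cfg w1 x1 y1 z1 0 p1 False) = Some (cfg a' b' c' d' 0 p1 False)"
    "a' \<le> b'" "b' \<le> c'" "c' \<le> d'" "{#a', b', c', d'#} = {#w1, x1, y1, z1#}"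
    using order_ABCD_cfg by metis
  have sum': "a' + b' + c' + d' = n" using sum_eq4[OF o'(5)] w1(4) by simp
  have "w1 \<in> {a', b', c', d'}" using set_eq4[OF o'(5)] by auto
  then have "a' \<le> w1" using o'(2-4) by auto
  then have a': "real a' < 2 * T" using w1(5) by linarith
  have "(L + 4) * real j \<le> (L + 4) * (L + 1)" using j L_ge by (intro mult_left_mono) auto
  then have p1: "real p1 \<le> R" using w1(6) R by linarith
  let ?M = "while_do (\<lambda>s. Min {content s VA, content s VB, content s VC} > 0) (loop_body n)"
  have "yields (Option.bind (set_evenness (cfg a' b' c' d' 0 p1 False)) ?M) finished"
  proof (cases "a' = 0")
    \<comment> \<open>The first phase may already have emptied a vessel; then the guard of the loop
      fails at once.\<close>
    case True
    have "0 \<le> L * lg" using L_ge lg_ge by simp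
    then show ?thesis using True p1
      by (simp add: set_evenness_def while_do.simps finished_def cfg_def)
  next
    case False
    then obtain e where s: "set_evenness (cfg a' b' c' d' 0 p1 False) = Some (cfg a' b' c' d' e p1 False)"
      "2 ^ e dvd a'" "2 ^ e dvd b'" "2 ^ e dvd c'"
      "\<not> (2 ^ (e + 1) dvd a' \<and> 2 ^ (e + 1) dvd b' \<and> 2 ^ (e + 1) dvd c')"
      using set_evenness_cfg[of a' b' c' d' 0 p1 False] by auto
    \<comment> \<open>The pool, as the largest content, holds at least
      \<open>n / 4 = T * lg\<close>, the reserve for \<open>e = 0\<close> and hence for any
      \<open>e\<close>.\<close>
    have "T * (lg - real e) \<le> T * lg" using T_pos by simp
    also have "\<dots> \<le> real d'" unfolding T_lg using sum' o'(2-4) by linarith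
    finally have "admissible n {#a', b', c'#} d' e" using s sum' by (auto simp: admissible_def)
    moreover have "0 \<le> pot e a' {#a', b', c'#}"
      using False s o'(2,3) by (auto simp: pot_def intro!: add_nonneg_nonneg gain_nonneg)
    moreover have "0 \<le> L * real e" using L_ge by (intro mult_nonneg_nonneg) linarith+
    ultimately have "balanced 0 a' b' c' d' e p1"
      using False o'(2,3) p1 by (simp add: balanced_def)
    then show ?thesis using s(1) loop_finishes a' by simp
  qed
  then show ?thesis
    unfolding four_vessel_pouring_def Let_def n[symmetric] init_cfg
    by (simp add: run.simps(2) o(1) W o'(1)) (simp add: set_evenness_def run.simps(2))
qed

end

theorem theorem31:
  shows "\<exists>K::real. \<forall>a b c d n :: nat.
    a > 0 \<and> b > 0 \<and> c > 0 \<and> d > 0 \<and> n = a + b + c + d \<longrightarrow>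
    (\<exists>s. four_vessel_pouring a b c d = Some s \<and>
         (\<exists>X. content s X = 0) \<and>
         real (pourings s) \<le> K * (log 2 (real n) * log 2 (log 2 (real n))))"
proof (intro exI[of _ 50] allI impI)
  fix a b c d n :: nat
  assume *: "a > 0 \<and> b > 0 \<and> c > 0 \<and> d > 0 \<and> n = a + b + c + d"
  define L where "L = log 2 (log 2 (real n))"
  interpret pouring_bound n "(L + 4) * (L + 1)"
    by standard (use * in linarith)
  have L: "1 \<le> L" "L \<le> log 2 (real n)" using L_ge L_le by (simp_all only: L_def)
  \<comment> \<open>Of the constant 50, the first phase takes 10, as \<open>L\<close> lies between 1
    and the logarithm of \<open>n\<close>, and the loop takes 40.\<close>
  have "(L + 4) * (L + 1) \<le> (5 * L) * (2 * log 2 (real n))"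
    using L by (intro mult_mono) auto
  moreover have "yields (four_vessel_pouring a b c d) finished"
    using algorithm_finishes * by (simp only: L_def)
  then obtain s where s: "four_vessel_pouring a b c d = Some s" "finished s"
    unfolding yields_def by auto
  moreover note s(2)[unfolded finished_def, folded L_def]
  moreover have "(5 * L) * (2 * log 2 (real n)) = 10 * (log 2 (real n) * L)"
    "40 * L * log 2 (real n) = 40 * (log 2 (real n) * L)" by simp_all
  ultimately have "content s VA = 0" "real (pourings s) \<le> 50 * (log 2 (real n) * L)"
    by auto
  with s(1) show "\<exists>s. four_vessel_pouring a b c d = Some s \<and> (\<exists>X. content s X = 0) \<and>
      real (pourings s) \<le> 50 * (log 2 (real n) * log 2 (log 2 (real n)))"
    unfolding L_def by (intro exI[of _ s] conjI exI[of _ VA])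
qed

end
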